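(* Consider the parametrized nonlinear program $\min_x f(x,\xi)$ subject to $h(x,\xi)=0$, $g(x,\xi)\le 0$, with $f:\mathbb{R}^n\times\Xi\to\mathbb{R}$, $h:\mathbb{R}^n\times\Xi\to\mathbb{R}^p$, $g:\mathbb{R}^n\times\Xi\to\mathbb{R}^m$ twice continuously differentiable in $(x,\xi)$ and $\Xi\subset\mathbb{R}^r$. Let $\bar x^\star$ be a regular minimizer for $\bar\xi\in\Xi$ with multiplier $(\bar\lambda^\star,\bar\mu^\star)$ (strict complementary slackness is not assumed), let $x^\star:\mathcal N\to\mathbb R^n$ and $(\lambda^\star,\mu^\star):\mathcal N\to\mathbb R^{p+m}$ be the associated continuous local solution and multiplier maps on a neighborhood $\mathcal N\subset\Xi$ of $\bar\xi$ (see context), and assume that $A(\bar\xi)$ is positive definite. Then $x^\star$ and $(\lambda^\star,\mu^\star)$ are locally Lipschitz at $\bar\xi$, with bounds for the Lipschitz constants given respectively by $$\ell_{x^\star}:=\sqrt{\frac{\lambda^{\max}_{A(\bar\xi)}}{\lambda^{\min}_{A(\bar\xi)}}}\left(\frac{\|L^\star(\bar\xi)\|}{\lambda^{\min}_{A(\bar\xi)}}+\frac{\|G^\star(\bar\xi)\|}{\sigma^{\min}_{B^\top(\bar\xi)}}\right),$$ $$\ell_{(\lambda^\star,\mu^\star)}:=\frac{\big(\lambda^{\max}_{A(\bar\xi)}\big)^{3/2}}{\sigma^{\min}_{B^\top(\bar\xi)}\big(\lambda^{\min}_{A(\bar\xi)}\big)^{1/2}}\left(\frac{\|L^\star(\bar\xi)\|}{\lambda^{\min}_{A(\bar\xi)}}+\frac{\|G^\star(\bar\xi)\|}{\sigma^{\min}_{B^\top(\bar\xi)}}\right),$$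 where the active set $\mathbf I^\star(\bar\xi)$ entering $B(\bar\xi)$ and $G^\star(\bar\xi)$ contains all active inequality constraints at $\bar x^\star$, including those with zero multiplier.
   Context: Feasible set: $\mathcal{X}(\xi)=\{x: h(x,\xi)=0,\ g(x,\xi)\le0\}$. For $x\in\mathcal X(\xi)$ let $\mathbf{I}^\xi_x=\{i: g_i(x,\xi)=0\}$ and $\bar{\mathbf{I}}^\xi_x=\{i: g_i(x,\xi)<0\}$. Lagrangian: $L(x,\lambda,\mu,\xi)=f(x,\xi)+\lambda^\top h(x,\xi)+\mu^\top g(x,\xi)$. LICQ at $x$: the gradients with respect to $x$ of all components of $h$ and of all active $g_i$, $i\in\mathbf I_x^\xi$, are linearly independent. KKT at $(x,\lambda,\mu)\in\mathcal X(\xi)\times\mathbb R^p\times\mathbb R^m_{\ge0}$: $\nabla_xL=0$ and $\mu_i=0$ for all $i\in\bar{\mathbf I}^\xi_x$. Strong second-order sufficiency condition (SSOSC): $y^\top\nabla^2_{xx}L\,y>0$ for all $y\ne0$ with $\nabla_xh(x,\xi)y=0$ and $\nabla_xg_i(x,\xi)y=0$ for all $i$ with $\mu_i>0$. A regular minimizer is a point $x$ with multiplier $(\lambda,\mu)$ satisfying LICQ, KKT and SSOSC. Local solution maps: by a classical sensitivity theorem, on a neighborhood $\mathcal{N}\subset\Xi$ of $\bar\xi$ there are continuous maps $x^\star:\mathcal N\to\mathbb R^n$, $\lambda^\star:\mathcal N\to\mathbb R^p$, $\mu^\star:\mathcal N\to\mathbb R^m_{\ge0}$ with $(x^\star,\lambda^\star,\mu^\star)(\bar\xi)=(\bar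 x^\star,\bar\lambda^\star,\bar\mu^\star)$ such that for all $\xi\in\mathcal N$ LICQ holds at $x^\star(\xi)$, KKT and SSOSC hold at $(x^\star(\xi),\lambda^\star(\xi),\mu^\star(\xi))$, and $x^\star(\xi)$ is a local minimizer with multiplier $(\lambda^\star(\xi),\mu^\star(\xi))$. The maps in the claim are these. Notation: $\mathbf I^\star(\xi)=\mathbf I^\xi_{x^\star(\xi)}$; $A(\xi)=\nabla^2_{xx}L$ ($n\times n$), $L^\star(\xi)=\nabla^2_{\xi x}L$ ($n\times r$, the Jacobian with respect to $\xi$ of the column gradient of $L$ with respect to $x$), both evaluated at $(x^\star(\xi),\lambda^\star(\xi),\mu^\star(\xi),\xi)$; $B(\xi)=\begin{bmatrix}\nabla_xh\\ \nabla_xg_{\mathbf I^\star(\xi)}\end{bmatrix}$ and $G^\star(\xi)=\begin{bmatrix}\nabla_\xi h\\ \nabla_\xi g_{\mathbf I^\star(\xi)}\end{bmatrix}$ evaluated at $(x^\star(\xi),\xi)$. $\|\cdot\|$ is the Euclidean norm or the induced operator norm; $\lambda^{\max},\lambda^{\min}$ are extreme eigenvalues of a symmetric matrix and $\sigma^{\min}_{B^\top}$ is the minimum singular value of the full-column-rank matrix $B^\top$. If there are no equality constraints and no active inequality constraints, the convention is $B=0$, $G^\star=0$, and the term $\|G^\star\|/\sigma^{\min}_{B^\top}$ is read as $0$. A map $F$ is locally $\ell'$-Lipschitz at a point $z$ if for every $\ell>\ell'$ there is a (relative) neighborhood of $z$ on which $\|F(y)-F(w)\|\le\ell\|y-w\|$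 for all $y,w$. *)

theory Defs
  imports "HOL-Analysis.Analysis"
begin

section \<open>Derivatives\<close>

text \<open>
  On a set that need not be open, being twice continuously differentiable means being so on an open
  superset. Second derivatives are Frechet derivatives of the derivative.
\<close>

definition C2_on :: "('a::real_normed_vector) set \<Rightarrow> ('a \<Rightarrow> real) \<Rightarrow> bool" where
  "C2_on S \<phi> \<longleftrightarrow>
     (\<exists>T (D :: 'a \<Rightarrow> 'a \<Rightarrow>\<^sub>L real) (D2 :: 'a \<Rightarrow> 'a \<Rightarrow>\<^sub>L ('a \<Rightarrow>\<^sub>L real)).
        open T \<and> S \<subseteq> T \<and>
        (\<forall>z\<in>T. (\<phi> has_derivative blinfun_apply (D z)) (at z)) \<and>
        (\<forall>z\<in>T. (D has_derivative blinfun_apply (D2 z)) (at z)) \<and>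
        continuous_on T D2)"

definition gradient :: "('a::real_inner \<Rightarrow> real) \<Rightarrow> 'a \<Rightarrow> 'a" where
  "gradient \<phi> z = (THE D. GDERIV \<phi> z :> D)"

definition grad_x :: "(real^'n \<Rightarrow> real^'r \<Rightarrow> real) \<Rightarrow> real^'n \<Rightarrow> real^'r \<Rightarrow> real^'n" where
  "grad_x \<phi> x \<xi> = gradient (\<lambda>u. \<phi> u \<xi>) x"

definition grad_xi :: "(real^'n \<Rightarrow> real^'r \<Rightarrow> real) \<Rightarrow> real^'n \<Rightarrow> real^'r \<Rightarrow> real^'r" where
  "grad_xi \<phi> x \<xi> = gradient (\<lambda>\<zeta>. \<phi> x \<zeta>) \<xi>"

definition hess_xx :: "(real^'n \<Rightarrow> real^'r \<Rightarrow> real) \<Rightarrow> real^'n \<Rightarrow> real^'r \<Rightarrow> real^'n^'n" where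
  "hess_xx \<phi> x \<xi> = jacobian (\<lambda>u. grad_x \<phi> u \<xi>) (at x)"

text \<open>An \<open>n \<times> r\<close> matrix: the Jacobian in \<open>\<xi>\<close> of the column gradient in \<open>x\<close>.\<close>

definition hess_xi_x :: "(real^'n \<Rightarrow> real^'r \<Rightarrow> real) \<Rightarrow> real^'n \<Rightarrow> real^'r \<Rightarrow> real^'r^'n" where
  "hess_xi_x \<phi> x \<xi> = jacobian (\<lambda>\<zeta>. grad_x \<phi> x \<zeta>) (at \<xi>)"


section \<open>Spectral quantities\<close>

definition pos_definite :: "real^'n^'n \<Rightarrow> bool" where
  "pos_definite A \<longleftrightarrow> (\<forall>y. y \<noteq> 0 \<longrightarrow> y \<bullet> (A *v y) > 0)"

definition eigenvalues :: "real^'n^'n \<Rightarrow> real set" where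
  "eigenvalues A = {k. \<exists>v. v \<noteq> 0 \<and> A *v v = k *\<^sub>R v}"

definition eig_max :: "real^'n^'n \<Rightarrow> real" where
  "eig_max A = Max (eigenvalues A)"

definition eig_min :: "real^'n^'n \<Rightarrow> real" where
  "eig_min A = Min (eigenvalues A)"

text \<open>
  A matrix whose set of rows varies is given by a finite index set \<open>J\<close>, possibly empty, and a family
  \<open>B\<close> of row vectors; it maps \<open>v\<close> to the family \<open>j \<mapsto> B j \<bullet> v\<close>, and the Euclidean norm of a
  \<open>J\<close>-indexed family is given by \<^const>\<open>L2_set\<close>.
\<close>

definition row_onorm :: "'j set \<Rightarrow> ('j \<Rightarrow> 'a::euclidean_space) \<Rightarrow> real" where
  "row_onorm J B = (SUP v. L2_set (\<lambda>j. B j \<bullet> v) J / norm v)"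

text \<open>
  The singular values of \<open>B\<^sup>T\<close>, which has the vectors \<open>B j\<close> as its columns, are the square roots of
  the eigenvalues of \<open>(B\<^sup>T)\<^sup>T B\<^sup>T = B B\<^sup>T\<close>, the Gram matrix with entries \<open>B i \<bullet> B j\<close>.
\<close>

definition transpose_singular_values :: "'j set \<Rightarrow> ('j \<Rightarrow> 'a::euclidean_space) \<Rightarrow> real set" where
  "transpose_singular_values J B =
     {s. s \<ge> 0 \<and> (\<exists>y. (\<exists>j\<in>J. y j \<noteq> 0) \<and>
           (\<forall>i\<in>J. (\<Sum>j\<in>J. (B i \<bullet> B j) * y j) = s\<^sup>2 * y i))}"

text \<open>
  Without rows the convention is \<open>B = 0\<close>, whose singular value is \<open>0\<close>; since \<open>x / 0 = 0\<close>, a quotient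
  by it is then read as \<open>0\<close>.
\<close>

definition sigma_min_transpose :: "'j set \<Rightarrow> ('j \<Rightarrow> 'a::euclidean_space) \<Rightarrow> real" where
  "sigma_min_transpose J B = (if J = {} then 0 else Min (transpose_singular_values J B))"


section \<open>Parametrized nonlinear programs\<close>

text \<open>
  The constraints are \<open>h i\<close> for \<open>i < p\<close> and \<open>g i\<close> for \<open>i < m\<close>, where \<open>p\<close> and \<open>m\<close> may be \<open>0\<close>;
  multipliers are likewise functions on \<open>nat\<close> of which only these entries matter.
\<close>

type_synonym ('n, 'r) pfun = "real^'n \<Rightarrow> real^'r \<Rightarrow> real"

definition feasible ::
  "nat \<Rightarrow> (nat \<Rightarrow> ('n::finite, 'r::finite) pfun) \<Rightarrow> nat \<Rightarrow> (nat \<Rightarrow> ('n, 'r) pfun) \<Rightarrow> real^'r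
     \<Rightarrow> (real^'n) set" where
  "feasible p h m g \<xi> = {x. (\<forall>i<p. h i x \<xi> = 0) \<and> (\<forall>i<m. g i x \<xi> \<le> 0)}"

definition active ::
  "nat \<Rightarrow> (nat \<Rightarrow> ('n::finite, 'r::finite) pfun) \<Rightarrow> real^'n \<Rightarrow> real^'r \<Rightarrow> nat set" where
  "active m g x \<xi> = {i. i < m \<and> g i x \<xi> = 0}"

text \<open>Row indices of \<open>B\<close> and \<open>G\<^sup>\<star>\<close>: all equality constraints and all active inequality constraints.\<close>

definition active_rows ::
  "nat \<Rightarrow> nat \<Rightarrow> (nat \<Rightarrow> ('n::finite, 'r::finite) pfun) \<Rightarrow> real^'n \<Rightarrow> real^'r
     \<Rightarrow> (nat + nat) set" where
  "active_rows p m g x \<xi> = {..<p} <+> active m g x \<xi>"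

definition constr_grad_x ::
  "(nat \<Rightarrow> ('n::finite, 'r::finite) pfun) \<Rightarrow> (nat \<Rightarrow> ('n, 'r) pfun) \<Rightarrow> real^'n \<Rightarrow> real^'r
     \<Rightarrow> nat + nat \<Rightarrow> real^'n" where
  "constr_grad_x h g x \<xi> j = grad_x (case_sum h g j) x \<xi>"

definition constr_grad_xi ::
  "(nat \<Rightarrow> ('n::finite, 'r::finite) pfun) \<Rightarrow> (nat \<Rightarrow> ('n, 'r) pfun) \<Rightarrow> real^'n \<Rightarrow> real^'r
     \<Rightarrow> nat + nat \<Rightarrow> real^'r" where
  "constr_grad_xi h g x \<xi> j = grad_xi (case_sum h g j) x \<xi>"

definition lagrangian ::
  "('n::finite, 'r::finite) pfun \<Rightarrow> nat \<Rightarrow> (nat \<Rightarrow> ('n, 'r) pfun) \<Rightarrow> nat \<Rightarrow> (nat \<Rightarrow> ('n, 'r) pfun)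
     \<Rightarrow> (nat \<Rightarrow> real) \<Rightarrow> (nat \<Rightarrow> real) \<Rightarrow> ('n, 'r) pfun" where
  "lagrangian f p h m g l \<mu> x \<xi> =
     f x \<xi> + (\<Sum>i<p. l i * h i x \<xi>) + (\<Sum>i<m. \<mu> i * g i x \<xi>)"

text \<open>Injectivity is needed because equal gradients of two constraints count as dependent.\<close>

definition LICQ ::
  "nat \<Rightarrow> (nat \<Rightarrow> ('n::finite, 'r::finite) pfun) \<Rightarrow> nat \<Rightarrow> (nat \<Rightarrow> ('n, 'r) pfun)
     \<Rightarrow> real^'r \<Rightarrow> real^'n \<Rightarrow> bool" where
  "LICQ p h m g \<xi> x \<longleftrightarrow>
     inj_on (constr_grad_x h g x \<xi>) (active_rows p m g x \<xi>) \<and>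
     independent (constr_grad_x h g x \<xi> ` active_rows p m g x \<xi>)"

definition KKT ::
  "('n::finite, 'r::finite) pfun \<Rightarrow> nat \<Rightarrow> (nat \<Rightarrow> ('n, 'r) pfun) \<Rightarrow> nat \<Rightarrow> (nat \<Rightarrow> ('n, 'r) pfun)
     \<Rightarrow> real^'r \<Rightarrow> real^'n \<Rightarrow> (nat \<Rightarrow> real) \<Rightarrow> (nat \<Rightarrow> real) \<Rightarrow> bool" where
  "KKT f p h m g \<xi> x l \<mu> \<longleftrightarrow>
     x \<in> feasible p h m g \<xi> \<and> (\<forall>i<m. \<mu> i \<ge> 0) \<and>
     grad_x (lagrangian f p h m g l \<mu>) x \<xi> = 0 \<and>
     (\<forall>i<m. g i x \<xi> < 0 \<longrightarrow> \<mu> i = 0)"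

definition SSOSC ::
  "('n::finite, 'r::finite) pfun \<Rightarrow> nat \<Rightarrow> (nat \<Rightarrow> ('n, 'r) pfun) \<Rightarrow> nat \<Rightarrow> (nat \<Rightarrow> ('n, 'r) pfun)
     \<Rightarrow> real^'r \<Rightarrow> real^'n \<Rightarrow> (nat \<Rightarrow> real) \<Rightarrow> (nat \<Rightarrow> real) \<Rightarrow> bool" where
  "SSOSC f p h m g \<xi> x l \<mu> \<longleftrightarrow>
     (\<forall>y. y \<noteq> 0 \<and> (\<forall>i<p. grad_x (h i) x \<xi> \<bullet> y = 0) \<and>
          (\<forall>i<m. \<mu> i > 0 \<longrightarrow> grad_x (g i) x \<xi> \<bullet> y = 0) \<longrightarrow>
          y \<bullet> (hess_xx (lagrangian f p h m g l \<mu>) x \<xi> *v y) > 0)"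

definition regular_minimizer ::
  "('n::finite, 'r::finite) pfun \<Rightarrow> nat \<Rightarrow> (nat \<Rightarrow> ('n, 'r) pfun) \<Rightarrow> nat \<Rightarrow> (nat \<Rightarrow> ('n, 'r) pfun)
     \<Rightarrow> real^'r \<Rightarrow> real^'n \<Rightarrow> (nat \<Rightarrow> real) \<Rightarrow> (nat \<Rightarrow> real) \<Rightarrow> bool" where
  "regular_minimizer f p h m g \<xi> x l \<mu> \<longleftrightarrow>
     LICQ p h m g \<xi> x \<and> KKT f p h m g \<xi> x l \<mu> \<and> SSOSC f p h m g \<xi> x l \<mu>"

definition local_minimizer ::
  "('n::finite, 'r::finite) pfun \<Rightarrow> nat \<Rightarrow> (nat \<Rightarrow> ('n, 'r) pfun) \<Rightarrow> nat \<Rightarrow> (nat \<Rightarrow> ('n, 'r) pfun)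
     \<Rightarrow> real^'r \<Rightarrow> real^'n \<Rightarrow> bool" where
  "local_minimizer f p h m g \<xi> x \<longleftrightarrow>
     x \<in> feasible p h m g \<xi> \<and>
     (\<exists>\<epsilon>>0. \<forall>y \<in> feasible p h m g \<xi> \<inter> ball x \<epsilon>. f x \<xi> \<le> f y \<xi>)"

definition rel_nhd :: "('a::topological_space) set \<Rightarrow> 'a set \<Rightarrow> 'a \<Rightarrow> bool" where
  "rel_nhd \<Xi> N z \<longleftrightarrow> N \<subseteq> \<Xi> \<and> (\<exists>V. open V \<and> z \<in> V \<and> \<Xi> \<inter> V \<subseteq> N)"

definition local_solution_maps ::
  "('n::finite, 'r::finite) pfun \<Rightarrow> nat \<Rightarrow> (nat \<Rightarrow> ('n, 'r) pfun) \<Rightarrow> nat \<Rightarrow> (nat \<Rightarrow> ('n, 'r) pfun)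
     \<Rightarrow> (real^'r) set \<Rightarrow> (real^'r \<Rightarrow> real^'n) \<Rightarrow> (real^'r \<Rightarrow> nat \<Rightarrow> real) \<Rightarrow> (real^'r \<Rightarrow> nat \<Rightarrow> real)
     \<Rightarrow> bool" where
  "local_solution_maps f p h m g N xs ls \<mu>s \<longleftrightarrow>
     continuous_on N xs \<and>
     (\<forall>i<p. continuous_on N (\<lambda>\<xi>. ls \<xi> i)) \<and>
     (\<forall>i<m. continuous_on N (\<lambda>\<xi>. \<mu>s \<xi> i)) \<and>
     (\<forall>\<xi>\<in>N. LICQ p h m g \<xi> (xs \<xi>) \<and>
             KKT f p h m g \<xi> (xs \<xi>) (ls \<xi>) (\<mu>s \<xi>) \<and>
             SSOSC f p h m g \<xi> (xs \<xi>) (ls \<xi>) (\<mu>s \<xi>) \<and>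
             local_minimizer f p h m g \<xi> (xs \<xi>))"


section \<open>Local Lipschitz continuity\<close>

text \<open>
  The distance on the codomain is a parameter, so that the notion also applies to multipliers.
\<close>

definition locally_lipschitz_at ::
  "('b \<Rightarrow> 'b \<Rightarrow> real) \<Rightarrow> real \<Rightarrow> 'a::real_normed_vector set \<Rightarrow> ('a \<Rightarrow> 'b) \<Rightarrow> 'a \<Rightarrow> bool" where
  "locally_lipschitz_at d K S F z \<longleftrightarrow>
     (\<forall>k>K. \<exists>V. open V \<and> z \<in> V \<and>
        (\<forall>y \<in> S \<inter> V. \<forall>w \<in> S \<inter> V. d (F y) (F w) \<le> k * norm (y - w)))"

definition mult_dist ::
  "nat \<Rightarrow> nat \<Rightarrow> (nat \<Rightarrow> real) \<times> (nat \<Rightarrow> real) \<Rightarrow> (nat \<Rightarrow> real) \<times> (nat \<Rightarrow> real) \<Rightarrow> real" where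
  "mult_dist p m a b =
     sqrt ((\<Sum>i<p. (fst a i - fst b i)\<^sup>2) + (\<Sum>i<m. (snd a i - snd b i)\<^sup>2))"

end

theory Submission
  imports Defs
begin

text \<open>
  The idea is to compare the KKT conditions at two nearby parameters directly, by a monotonicity argument
  that is insensitive to the shape of the parameter set and to changes of the active set between the two
  parameters.
  
  Let \<open>dx\<close>, \<open>dy\<close>, \<open>d\<xi>\<close> be the differences of solutions, multipliers and parameters, and \<open>dc j\<close> that of the
  values of the constraint \<open>j\<close>. Up to errors that are small relative to \<open>dx\<close>, \<open>dy\<close> and \<open>d\<xi>\<close>, stationarity
  and Taylor expansion give \<open>A dx + L d\<xi> + B\<^sup>T dy = 0\<close> and \<open>B dx + G d\<xi> = dc\<close>
  (\<open>stationarity_expansion\<close>, \<open>family_expansion\<close>). Only the rows active at the base point occur, because the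
  other constraints remain inactive nearby. What is known about \<open>dc\<close> is a sign:
  complementary slackness at the two points gives \<open>dy j * dc j \<ge> 0\<close> for every \<open>j\<close> (\<open>KKT_monotone\<close>).
  
  For the linear system this sign suffices (\<open>monotone_saddle_point_bounds\<close>). Measured in the inner product
  defined by \<open>A\<close>, pairing stationarity with \<open>dx\<close> yields
  \<open>\<langle>dx, dx + A\<^sup>-\<^sup>1 L d\<xi>\<rangle> \<le> dy \<bullet> G d\<xi>\<close>, and \<open>dy\<close> is controlled by \<open>dx + A\<^sup>-\<^sup>1 L d\<xi>\<close> through the least
  singular value of \<open>B\<^sup>T\<close>, which is positive by LICQ (\<open>sigma_min_transpose_bound\<close>). Polarization then
  bounds \<open>dx\<close>, and afterwards \<open>dy\<close>, with constants that are at most the claimed ones.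
  
  The errors are treated as perturbations of \<open>L d\<xi>\<close> and \<open>G d\<xi>\<close>; since they are small relative to the total
  change, they only enlarge the Lipschitz constant by an arbitrarily small amount
  (\<open>absorb_relative_error\<close>), which is what local Lipschitz continuity at the base point allows.
  The required expansions come from strict derivatives of \<open>C\<^sup>2\<close> functions; the same tool gives the symmetry
  of the Hessian, without which its extreme eigenvalues would not bound its quadratic form.
\<close>

section \<open>Self-adjoint operators and extreme eigenvalues\<close>

lemma semidefinite_Cauchy_Schwarz:
  fixes T :: "'a::euclidean_space \<Rightarrow> 'a"
  assumes lin: "linear T" and sa: "\<And>u v. T u \<bullet> v = u \<bullet> T v"
    and S: "subspace S" and psd: "\<And>u. u \<in> S \<Longrightarrow> 0 \<le> u \<bullet> T u"
    and u: "u \<in> S" and v: "v \<in> S"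
  shows "(u \<bullet> T v)\<^sup>2 \<le> (u \<bullet> T u) * (v \<bullet> T v)"
proof -
  define a b c where "a = u \<bullet> T u" "b = u \<bullet> T v" "c = v \<bullet> T v"
  have quad: "0 \<le> a + 2 * t * b + t\<^sup>2 * c" for t
  proof -
    have "u + t *\<^sub>R v \<in> S"
      using S u v by (simp add: subspace_add subspace_mul)
    from psd[OF this] show ?thesis
      using sa[of v u]
      by (simp add: linear_add[OF lin] linear_cmul[OF lin] inner_add_left inner_add_right
          a_b_c_def algebra_simps power2_eq_square inner_commute)
  qed
  have c0: "c \<ge> 0" using psd[OF v] by (simp add: a_b_c_def)
  have "b\<^sup>2 \<le> a * c"
  proof (cases "c = 0")
    case True
    have "b = 0"
    proof (rule ccontr)
      assume "b \<noteq> 0"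
      \<comment> \<open>The affine function \<open>a + 2 * t * b\<close> takes the value \<open>- 1\<close> at this \<open>t\<close>.\<close>
      then show False using quad[of "- (a + 1) / (2 * b)"] True by (simp add: field_simps)
    qed
    then show ?thesis using True by simp
  next
    case False
    then have "c > 0" using c0 by simp
    then show ?thesis using quad[of "- b / c"]
      by (simp add: field_simps power2_eq_square)
  qed
  then show ?thesis by (simp add: a_b_c_def)
qed

text \<open>
  A minimizer \<open>v\<close> of the Rayleigh quotient on the unit sphere of \<open>S\<close>, with value \<open>k\<close>, is an
  eigenvector: \<open>T - k\<close> is semidefinite on \<open>S\<close> and its form vanishes at \<open>v\<close>, so by Cauchy-Schwarz for this
  form \<open>(T - k) v\<close> is orthogonal to all of \<open>S\<close>, hence to itself. The invariant subspace \<open>S\<close> is the whole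
  space for the Hessian and the span of the rows for singular values.
\<close>

lemma selfadjoint_min_eigenvector:
  fixes T :: "'a::euclidean_space \<Rightarrow> 'a"
  assumes lin: "linear T" and sa: "\<And>u v. T u \<bullet> v = u \<bullet> T v"
    and S: "subspace S" and inv: "\<And>v. v \<in> S \<Longrightarrow> T v \<in> S" and nz: "w \<in> S" "w \<noteq> 0"
  obtains v k where "v \<in> S" "v \<noteq> 0" "T v = k *\<^sub>R v"
    "\<And>u. u \<in> S \<Longrightarrow> k * (norm u)\<^sup>2 \<le> u \<bullet> T u"
proof -
  let ?K = "S \<inter> sphere 0 1"
  have "compact ?K"
    by (intro closed_Int_compact closed_subspace S compact_sphere)
  moreover have "(1 / norm w) *\<^sub>R w \<in> ?K"
    using nz S by (simp add: subspace_mul)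
  then have "?K \<noteq> {}" by blast
  moreover have "continuous_on ?K (\<lambda>u. u \<bullet> T u)"
    by (intro continuous_intros linear_continuous_on linear_conv_bounded_linear[THEN iffD1] lin)
  ultimately obtain v where v: "v \<in> ?K" and le: "\<And>u. u \<in> ?K \<Longrightarrow> v \<bullet> T v \<le> u \<bullet> T u"
    by (metis continuous_attains_inf)
  define k where "k = v \<bullet> T v"
  have rayleigh: "k * (norm u)\<^sup>2 \<le> u \<bullet> T u" if "u \<in> S" for u
  proof (cases "u = 0")
    case False
    then have "(1 / norm u) *\<^sub>R u \<in> ?K"
      using that S by (simp add: subspace_mul)
    from le[OF this] False show ?thesis
      by (simp add: linear_cmul[OF lin] k_def field_simps power2_eq_square)
  qed simp
  define R where "R u = T u - k *\<^sub>R u" for u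
  have linR: "linear R"
    unfolding R_def by (intro linear_compose_sub lin linear_scale_self)
  have saR: "R a \<bullet> b = a \<bullet> R b" for a b
    by (simp add: R_def inner_diff sa)
  have psdR: "0 \<le> a \<bullet> R a" if "a \<in> S" for a
    using rayleigh[OF that] by (simp add: R_def inner_diff power2_norm_eq_inner)
  have Rv: "R v \<in> S" using v S inv by (simp add: R_def subspace_diff subspace_mul)
  have "v \<bullet> R v = 0"
    using v by (simp add: R_def inner_diff k_def dot_square_norm)
  then have "(R v \<bullet> R v)\<^sup>2 \<le> 0"
    using semidefinite_Cauchy_Schwarz[OF linR saR S psdR Rv, of v] v by simp
  then have "R v = 0" by simp
  then have "T v = k *\<^sub>R v" by (simp add: R_def)
  moreover have "v \<noteq> 0" using v by auto
  ultimately show ?thesis using that[of v k] v rayleigh by blast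
qed

text \<open>
  Eigenvectors to distinct eigenvalues are orthogonal, so there are at most as many eigenvalues as
  dimensions. Finiteness is what makes the \<open>Max\<close> and \<open>Min\<close> in the spectral quantities meaningful.
\<close>

lemma finite_selfadjoint_eigenvalues:
  fixes T :: "'a::euclidean_space \<Rightarrow> 'a"
  assumes sa: "\<And>u v. T u \<bullet> v = u \<bullet> T v"
  shows "finite {k. \<exists>v. v \<noteq> 0 \<and> T v = k *\<^sub>R v}" (is "finite ?E")
proof -
  define E where "E = ?E"
  define v where "v k = (SOME v. v \<noteq> 0 \<and> T v = k *\<^sub>R v)" for k
  have v: "v k \<noteq> 0" "T (v k) = k *\<^sub>R v k" if "k \<in> E" for k
    using someI_ex[of "\<lambda>v. v \<noteq> 0 \<and> T v = k *\<^sub>R v"] that unfolding E_def v_def by blast+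
  have orth: "orthogonal (v k) (v l)" if "k \<in> E" "l \<in> E" "k \<noteq> l" for k l
  proof -
    have "k * (v k \<bullet> v l) = l * (v k \<bullet> v l)"
      using sa[of "v k" "v l"] unfolding v(2)[OF that(1)] v(2)[OF that(2)] by simp
    then show ?thesis using that(3) by (simp add: orthogonal_def)
  qed
  have inj: "inj_on v E"
    by (rule inj_onI) (metis orth orthogonal_self v(1))
  have "pairwise orthogonal (v ` E)"
    unfolding pairwise_def using orth by blast
  moreover have "0 \<notin> v ` E" using v(1) by force
  ultimately have "finite (v ` E)"
    using pairwise_orthogonal_independent independent_imp_finite by blast
  then have "finite E" using inj by (rule finite_imageD)
  then show ?thesis unfolding E_def .
qed

lemma eigenvalue_bounds:
  fixes A :: "real^'n^'n"
  assumes sa: "\<And>u v. (A *v u) \<bullet> v = u \<bullet> (A *v v)"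
  shows eig_min_le_quadratic_form: "eig_min A * (norm u)\<^sup>2 \<le> u \<bullet> (A *v u)"
    and quadratic_form_le_eig_max: "u \<bullet> (A *v u) \<le> eig_max A * (norm u)\<^sup>2"
    and eig_min_le_eig_max: "eig_min A \<le> eig_max A"
    and pos_definite_imp_eig_min_pos: "pos_definite A \<Longrightarrow> 0 < eig_min A"
proof -
  have fin: "finite (eigenvalues A)"
    unfolding eigenvalues_def by (rule finite_selfadjoint_eigenvalues) (rule sa)
  obtain w :: "real^'n" where w: "w \<noteq> 0"
    using nonempty_Basis nonzero_Basis by blast
  obtain v k where v: "v \<noteq> 0" "A *v v = k *\<^sub>R v" "\<And>u. k * (norm u)\<^sup>2 \<le> u \<bullet> (A *v u)"
    by (rule selfadjoint_min_eigenvector[OF matrix_vector_mul_linear[of A] sa subspace_UNIV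
        UNIV_I UNIV_I w]) (use UNIV_I in metis)
  have sa': "- (A *v u) \<bullet> v = u \<bullet> - (A *v v)" for u v
    by (simp add: sa)
  \<comment> \<open>The largest eigenvalue is minus the smallest one of \<open>- A\<close>.\<close>
  obtain v' k' where v': "v' \<noteq> 0" "- (A *v v') = k' *\<^sub>R v'"
    "\<And>u. k' * (norm u)\<^sup>2 \<le> u \<bullet> - (A *v u)"
    by (rule selfadjoint_min_eigenvector[OF linear_compose_neg[OF matrix_vector_mul_linear[of A]]
        sa' subspace_UNIV UNIV_I UNIV_I w]) (use UNIV_I in metis)
  have k: "k \<in> eigenvalues A" using v unfolding eigenvalues_def by blast
  have "A *v v' = (- k') *\<^sub>R v'" using v'(2) by (metis minus_minus scaleR_minus_left)
  then have k': "- k' \<in> eigenvalues A" using v' unfolding eigenvalues_def by blast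
  show "eig_min A * (norm u)\<^sup>2 \<le> u \<bullet> (A *v u)"
    using mult_right_mono[OF Min_le[OF fin k], of "(norm u)\<^sup>2"] v(3)[of u]
    unfolding eig_min_def by simp
  show "u \<bullet> (A *v u) \<le> eig_max A * (norm u)\<^sup>2"
    using mult_right_mono[OF Max_ge[OF fin k'], of "(norm u)\<^sup>2"] v'(3)[of u]
    unfolding eig_max_def by simp
  show "eig_min A \<le> eig_max A"
    using Min_le[OF fin k] Max_ge[OF fin k] unfolding eig_min_def eig_max_def by simp
  assume pd: "pos_definite A"
  have "eig_min A \<in> eigenvalues A"
    unfolding eig_min_def using Min_in fin k by blast
  then obtain z where "z \<noteq> 0" "A *v z = eig_min A *\<^sub>R z"
    unfolding eigenvalues_def by blast
  then show "0 < eig_min A"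
    using pd inner_gt_zero_iff[of z] unfolding pos_definite_def
    by (metis inner_scaleR_right zero_less_mult_pos2)
qed

section \<open>Families of row vectors\<close>

lemma row_onorm_bound:
  fixes B :: "'j \<Rightarrow> 'a::euclidean_space"
  shows "L2_set (\<lambda>j. B j \<bullet> v) J \<le> row_onorm J B * norm v"
proof (cases "v = 0")
  case True
  then show ?thesis by (simp add: L2_set_0')
next
  case False
  have "L2_set (\<lambda>j. B j \<bullet> u) J / norm u \<le> (\<Sum>j\<in>J. norm (B j))" for u
  proof (cases "u = 0")
    case False
    have "L2_set (\<lambda>j. B j \<bullet> u) J \<le> (\<Sum>j\<in>J. \<bar>B j \<bullet> u\<bar>)" by (rule L2_set_le_sum_abs)
    also have "\<dots> \<le> (\<Sum>j\<in>J. norm (B j) * norm u)"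
      by (intro sum_mono Cauchy_Schwarz_ineq2)
    finally have "L2_set (\<lambda>j. B j \<bullet> u) J \<le> (\<Sum>j\<in>J. norm (B j)) * norm u"
      by (simp add: sum_distrib_right)
    then show ?thesis using False by (simp add: divide_le_eq)
  qed (simp add: sum_nonneg)
  then have "bdd_above (range (\<lambda>u. L2_set (\<lambda>j. B j \<bullet> u) J / norm u))"
    by (intro bdd_aboveI2)
  then have "L2_set (\<lambda>j. B j \<bullet> v) J / norm v \<le> row_onorm J B"
    unfolding row_onorm_def by (intro cSUP_upper) auto
  then show ?thesis using False by (simp add: field_simps)
qed

lemma row_onorm_nonneg: "0 \<le> row_onorm J (B :: 'j \<Rightarrow> 'a::euclidean_space)"
proof -
  obtain v :: 'a where "norm v = 1" using norm_Basis nonempty_Basis by blast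
  then show ?thesis
    using order_trans[OF L2_set_nonneg row_onorm_bound[of B v J]] by simp
qed

text \<open>
  The nonzero eigenvalues of the Gram matrix \<open>B B\<^sup>T\<close> are those of \<open>T = B\<^sup>T B\<close>, which acts on the
  Euclidean space that contains the rows, where the spectral lemmas apply. On the span of the rows \<open>T\<close> is
  positive definite, and its smallest eigenvalue there is the square of a singular value.
\<close>

lemma sigma_min_transpose_bound:
  fixes B :: "'j \<Rightarrow> 'a::euclidean_space"
  assumes fin: "finite J" and ne: "J \<noteq> {}" and inj: "inj_on B J" and ind: "independent (B ` J)"
  shows sigma_min_transpose_pos: "0 < sigma_min_transpose J B"
    and "sigma_min_transpose J B * L2_set y J \<le> norm (\<Sum>j\<in>J. y j *\<^sub>R B j)"
proof -
  define T where "T v = (\<Sum>j\<in>J. (B j \<bullet> v) *\<^sub>R B j)" for v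
  let ?S = "span (B ` J)"
  let ?V = "transpose_singular_values J B"
  have lin: "linear T"
    unfolding T_def
    by (intro linear_compose_sum ballI bounded_linear.linear bounded_linear_scaleR_const
        bounded_linear_inner_right)
  have sa: "T u \<bullet> v = u \<bullet> T v" for u v
    by (simp add: T_def inner_sum_left inner_sum_right inner_commute mult.commute)
  have form: "v \<bullet> T v = (L2_set (\<lambda>j. B j \<bullet> v) J)\<^sup>2" for v
    by (simp add: T_def inner_sum_right L2_set_def sum_nonneg inner_commute power2_eq_square)
  have comb0: "\<forall>j\<in>J. c j = 0" if "(\<Sum>j\<in>J. c j *\<^sub>R B j) = 0" for c
  proof -
    have "(\<Sum>x\<in>B ` J. c (inv_into J B x) *\<^sub>R x) = 0"
      using that inj by (simp add: sum.reindex)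
    then have "\<forall>x\<in>B ` J. c (inv_into J B x) = 0"
      using ind fin by (auto simp: independent_explicit)
    then show ?thesis using inj by auto
  qed
  have comb_span: "(\<Sum>j\<in>J. c j *\<^sub>R B j) \<in> ?S" for c
    by (intro span_sum span_mul span_base imageI)
  have eigen: "s > 0 \<and> s\<^sup>2 \<in> {k. \<exists>v. v \<noteq> 0 \<and> T v = k *\<^sub>R v}" if s: "s \<in> ?V" for s
  proof -
    obtain y where s0: "s \<ge> 0" and y: "\<exists>j\<in>J. y j \<noteq> 0"
      and eq: "\<And>i. i \<in> J \<Longrightarrow> (\<Sum>j\<in>J. (B i \<bullet> B j) * y j) = s\<^sup>2 * y i"
      using s unfolding transpose_singular_values_def by blast
    define v where "v = (\<Sum>j\<in>J. y j *\<^sub>R B j)"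
    have "v \<noteq> 0" using comb0 y unfolding v_def by blast
    have Bv: "B i \<bullet> v = s\<^sup>2 * y i" if "i \<in> J" for i
      using eq[OF that] by (simp add: v_def inner_sum_right mult.commute)
    have "T v = (\<Sum>j\<in>J. (s\<^sup>2 * y j) *\<^sub>R B j)"
      unfolding T_def by (intro sum.cong) (simp_all add: Bv)
    then have "T v = s\<^sup>2 *\<^sub>R v"
      by (simp add: v_def scaleR_sum_right)
    moreover have "s \<noteq> 0"
    proof
      assume "s = 0"
      then have "v \<bullet> v = 0" using Bv
        by (subst (1) v_def) (simp add: inner_sum_left)
      then show False using \<open>v \<noteq> 0\<close> by simp
    qed
    ultimately show ?thesis using s0 \<open>v \<noteq> 0\<close> by auto
  qed
  have finV: "finite ?V"
  proof (rule finite_imageD)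
    show "finite ((\<lambda>s. s\<^sup>2) ` ?V)"
      by (rule finite_subset[OF _ finite_selfadjoint_eigenvalues[of T, OF sa]])
        (use eigen in blast)
    show "inj_on (\<lambda>s. s\<^sup>2) ?V"
    proof (rule inj_onI)
      fix s t assume st: "s \<in> ?V" "t \<in> ?V" "s\<^sup>2 = t\<^sup>2"
      then have "0 \<le> s" "0 \<le> t" using eigen by (meson less_imp_le)+
      then show "s = t" using st(3) by simp
    qed
  qed
  obtain j0 where j0: "j0 \<in> J" using ne by blast
  have B0: "B j0 \<noteq> 0" using ind j0 dependent_zero[of "B ` J"] by (metis imageI)
  have B0S: "B j0 \<in> ?S" using j0 by (simp add: span_base)
  have TS: "T u \<in> ?S" for u unfolding T_def by (rule comb_span)
  obtain v k where v: "v \<in> ?S" "v \<noteq> 0" "T v = k *\<^sub>R v"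
    and k: "\<And>u. u \<in> ?S \<Longrightarrow> k * (norm u)\<^sup>2 \<le> u \<bullet> T u"
    by (rule selfadjoint_min_eigenvector[OF lin sa subspace_span TS B0S B0]) (rule that)
  have "k * (norm v)\<^sup>2 = (L2_set (\<lambda>j. B j \<bullet> v) J)\<^sup>2"
    using form[of v] v(3) by (simp add: power2_norm_eq_inner)
  then have k0: "k \<ge> 0"
    using v(2) by (metis zero_le_mult_iff zero_le_power2 zero_less_norm_iff
        zero_less_power not_less)
  have "\<exists>j\<in>J. B j \<bullet> v \<noteq> 0"
  proof (rule ccontr)
    assume "\<not> ?thesis"
    then have "orthogonal v u" if "u \<in> B ` J" for u
      using that by (auto simp: orthogonal_def inner_commute)
    then have "orthogonal v v" using orthogonal_to_span v(1) by blast
    then show False using v(2) by (simp add: orthogonal_self)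
  qed
  moreover have "(\<Sum>j\<in>J. (B i \<bullet> B j) * (B j \<bullet> v)) = k * (B i \<bullet> v)" for i
  proof -
    have "(\<Sum>j\<in>J. (B i \<bullet> B j) * (B j \<bullet> v)) = B i \<bullet> T v"
      by (simp add: T_def inner_sum_right mult.commute)
    then show ?thesis using v(3) by simp
  qed
  ultimately have rootk: "sqrt k \<in> ?V"
    unfolding transpose_singular_values_def using k0
    by (intro CollectI conjI exI[of _ "\<lambda>j. B j \<bullet> v"]) auto
  define \<sigma> where "\<sigma> = sigma_min_transpose J B"
  have \<sigma>: "\<sigma> = Min ?V" using ne by (simp add: \<sigma>_def sigma_min_transpose_def)
  have "\<sigma> \<in> ?V" using Min_in finV rootk unfolding \<sigma> by blast
  then show pos: "0 < sigma_min_transpose J B" using eigen \<sigma>_def by blast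
  have "\<sigma> \<le> sqrt k" unfolding \<sigma> using finV rootk by (rule Min_le)
  then have \<sigma>k: "\<sigma> * norm u \<le> L2_set (\<lambda>j. B j \<bullet> u) J" if "u \<in> ?S" for u
  proof -
    have "(sqrt k * norm u)\<^sup>2 \<le> (L2_set (\<lambda>j. B j \<bullet> u) J)\<^sup>2"
      using k[OF that] form[of u] k0 by (simp add: power_mult_distrib)
    then have "sqrt k * norm u \<le> L2_set (\<lambda>j. B j \<bullet> u) J"
      by (rule power2_le_imp_le) simp
    then show ?thesis
      using mult_right_mono[OF \<open>\<sigma> \<le> sqrt k\<close>, of "norm u"] by simp
  qed
  \<comment> \<open>Every \<open>y\<close> is of the form \<open>j \<mapsto> B j \<bullet> u\<close> with \<open>u\<close> in the row space, because the rows are independent;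
    pairing with \<open>u\<close> turns the lower bound for the row map into one for its transpose.\<close>
  obtain l where l: "linear l" "\<And>x. x \<in> B ` J \<Longrightarrow> l x = y (inv_into J B x)"
    using linear_independent_extend[OF ind, of "\<lambda>x. y (inv_into J B x)"] by blast
  define u0 where "u0 = adjoint l 1"
  have u0: "B j \<bullet> u0 = y j" if "j \<in> J" for j
    using adjoint_works[OF l(1), of "B j" 1] l(2)[of "B j"] that inj
    by (simp add: u0_def)
  obtain u z where u: "u \<in> ?S" and z: "\<And>w. w \<in> ?S \<Longrightarrow> orthogonal z w" and "u0 = u + z"
    using orthogonal_subspace_decomp_exists[of "B ` J" u0] by metis
  have Bu: "B j \<bullet> u = y j" if "j \<in> J" for j
    using u0[OF that] z[OF span_base, of "B j"] that
    by (simp add: \<open>u0 = u + z\<close> inner_add_right orthogonal_def inner_commute)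
  let ?w = "\<Sum>j\<in>J. y j *\<^sub>R B j"
  have L2: "L2_set (\<lambda>j. B j \<bullet> u) J = L2_set y J"
    by (rule L2_set_cong) (auto simp: Bu)
  have "(L2_set y J)\<^sup>2 = ?w \<bullet> u"
    by (simp add: L2_set_def sum_nonneg inner_sum_left Bu power2_eq_square cong: sum.cong)
  also have "\<dots> \<le> norm ?w * norm u" by (rule norm_cauchy_schwarz)
  finally have 1: "L2_set y J * L2_set y J \<le> norm ?w * norm u" by (simp add: power2_eq_square)
  have "\<sigma> * L2_set y J * L2_set y J \<le> norm ?w * (\<sigma> * norm u)"
    using mult_left_mono[OF 1, of \<sigma>] pos by (simp add: \<sigma>_def algebra_simps)
  also have "\<dots> \<le> norm ?w * L2_set y J"
    using \<sigma>k[OF u] L2 by (intro mult_left_mono) auto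
  finally have 2: "\<sigma> * L2_set y J * L2_set y J \<le> norm ?w * L2_set y J" .
  have "\<sigma> * L2_set y J \<le> norm ?w"
  proof (cases "L2_set y J = 0")
    case False
    then have "0 < L2_set y J" by (simp add: less_le)
    then show ?thesis using 2 by simp
  qed simp
  then show "sigma_min_transpose J B * L2_set y J \<le> norm ?w" by (simp add: \<sigma>_def)
qed

section \<open>Stability of the linearized optimality system\<close>

text \<open>
  This is the estimate behind both Lipschitz constants; \<open>\<tau>\<close> stands for \<open>1 / \<sigma>\<close>. Let \<open>s\<close> solve \<open>A s = q\<close>
  and write \<open>\<langle>u, v\<rangle> = u \<bullet> A v\<close>, with norm \<open>nA\<close>. The stationarity equation says that
  \<open>A (x + s) = - B\<^sup>T y\<close>. Pairing it with \<open>x\<close> and using the sign condition gives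
  \<open>\<langle>x, x + s\<rangle> \<le> y \<bullet> r\<close>, and since \<open>y\<close> is at most \<open>sqrt hi * \<tau>\<close> times \<open>nA (x + s)\<close>, this is
  \<open>\<langle>x, x + s\<rangle> \<le> c * nA (x + s)\<close> with \<open>c = sqrt hi * \<tau> * L2_set r J\<close>. By polarization
  \<open>(nA x)\<^sup>2 \<le> (nA s)\<^sup>2 + c\<^sup>2\<close>. Expanding only the left factor \<open>x = (x + s) - s\<close> gives
  \<open>nA (x + s) \<le> nA s + c\<close>, which bounds \<open>y\<close>.
  
  The sign condition replaces the equation \<open>B x + r = 0\<close> that would hold with a fixed active set, and costs
  nothing in the constants.
\<close>

lemma monotone_saddle_point_bounds:
  fixes A :: "'a::euclidean_space \<Rightarrow> 'a" and B :: "'j \<Rightarrow> 'a"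
  assumes lin: "linear A" and sa: "\<And>u v. A u \<bullet> v = u \<bullet> A v"
    and lo: "0 < lo" "\<And>u. lo * (norm u)\<^sup>2 \<le> u \<bullet> A u"
    and hi: "lo \<le> hi" "\<And>u. u \<bullet> A u \<le> hi * (norm u)\<^sup>2"
    and \<tau>: "0 \<le> \<tau>" "L2_set y J \<le> \<tau> * norm (\<Sum>j\<in>J. y j *\<^sub>R B j)"
    and stat: "A x + q + (\<Sum>j\<in>J. y j *\<^sub>R B j) = 0"
    and mono: "\<And>j. j \<in> J \<Longrightarrow> 0 \<le> y j * (B j \<bullet> x + r j)"
  shows "norm x \<le> sqrt (hi / lo) * (norm q / lo + \<tau> * L2_set r J)"
    and "L2_set y J \<le> hi powr (3/2) * \<tau> / lo powr (1/2) * (norm q / lo + \<tau> * L2_set r J)"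
proof -
  have pos: "0 < u \<bullet> A u" if "u \<noteq> 0" for u
    using lo(2)[of u] lo(1) that
    by (meson less_le_trans mult_pos_pos zero_less_norm_iff zero_less_power)
  then have nonneg: "0 \<le> u \<bullet> A u" for u
    by (cases "u = 0") (auto intro: less_imp_le)
  have "inj A"
    unfolding linear_injective_0[OF lin] using pos by force
  then obtain s where s: "A s = q"
    using linear_injective_imp_surjective[OF lin] by (metis surjD)
  define nA where "nA u = sqrt (u \<bullet> A u)" for u
  have nA2: "(nA u)\<^sup>2 = u \<bullet> A u" and nA0: "0 \<le> nA u" for u
    using nonneg[of u] by (simp_all add: nA_def)
  let ?w = "\<Sum>j\<in>J. y j *\<^sub>R B j"
  define c where "c = sqrt hi * \<tau> * L2_set r J"
  have hi0: "0 < hi" using lo hi by simp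
  have c0: "0 \<le> c" using \<tau> hi0 by (simp add: c_def)
  \<comment> \<open>Cauchy-Schwarz for \<open>A u \<bullet> A u\<close>, read as the \<open>A\<close>-inner product of \<open>A u\<close> and \<open>u\<close>.\<close>
  have A_le: "norm (A u) \<le> sqrt hi * nA u" for u
  proof -
    have "(norm (A u) ^ 2)\<^sup>2 \<le> (A u \<bullet> A (A u)) * (u \<bullet> A u)"
      using semidefinite_Cauchy_Schwarz[OF lin sa subspace_UNIV nonneg, of "A u" u]
      by (simp add: power2_norm_eq_inner)
    also have "\<dots> \<le> hi * (norm (A u))\<^sup>2 * (u \<bullet> A u)"
      by (intro mult_right_mono hi nonneg)
    finally have "(norm (A u))\<^sup>2 * (norm (A u))\<^sup>2 \<le> (norm (A u))\<^sup>2 * (hi * (u \<bullet> A u))"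
      by (simp add: power2_eq_square algebra_simps)
    then have "(norm (A u))\<^sup>2 \<le> hi * (u \<bullet> A u)"
      using hi0 nonneg[of u] by (cases "A u = 0") (simp, metis mult_le_cancel_left_pos
          zero_less_norm_iff zero_less_power)
    then have "norm (A u) \<le> sqrt (hi * (u \<bullet> A u))" by (rule real_le_rsqrt)
    then show ?thesis by (simp add: real_sqrt_mult nA_def)
  qed
  have w: "?w = - A (x + s)"
    using stat s by (simp add: linear_add[OF lin] eq_neg_iff_add_eq_0 algebra_simps)
  have "L2_set y J \<le> \<tau> * norm (A (x + s))" using \<tau>(2) unfolding w by simp
  also have "\<dots> \<le> \<tau> * (sqrt hi * nA (x + s))" by (intro mult_left_mono A_le \<tau>)
  finally have y_le: "L2_set y J \<le> sqrt hi * \<tau> * nA (x + s)" by (simp add: algebra_simps)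
  have "x \<bullet> A (x + s) = - (\<Sum>j\<in>J. y j * (B j \<bullet> x))"
  proof -
    have "x \<bullet> ?w = - (x \<bullet> A (x + s))" unfolding w by simp
    then show ?thesis by (simp add: inner_sum_right inner_commute)
  qed
  also have "\<dots> \<le> (\<Sum>j\<in>J. y j * r j)"
    using sum_nonneg[of J "\<lambda>j. y j * (B j \<bullet> x + r j)"] mono
    by (simp add: algebra_simps sum.distrib)
  also have "\<dots> \<le> (\<Sum>j\<in>J. \<bar>y j\<bar> * \<bar>r j\<bar>)"
    by (intro sum_mono) (simp flip: abs_mult)
  also have "\<dots> \<le> L2_set y J * L2_set r J" by (rule L2_set_mult_ineq)
  also have "\<dots> \<le> c * nA (x + s)"
    using mult_right_mono[OF y_le, of "L2_set r J"] by (simp add: c_def algebra_simps)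
  finally have key: "x \<bullet> A (x + s) \<le> c * nA (x + s)" .
  have polar: "2 * (x \<bullet> A (x + s)) = (nA x)\<^sup>2 + (nA (x + s))\<^sup>2 - (nA s)\<^sup>2"
    using sa[of s x]
    by (simp add: nA2 linear_add[OF lin] inner_add_left inner_add_right inner_commute)
  have "(nA x)\<^sup>2 \<le> (nA s)\<^sup>2 + c\<^sup>2"
    using key polar sum_squares_bound[of c "nA (x + s)"] by (simp add: algebra_simps)
  also have "\<dots> \<le> (nA s + c)\<^sup>2" using nA0 c0 by (simp add: power2_sum)
  finally have x1: "nA x \<le> nA s + c" by (rule power2_le_imp_le) (use nA0 c0 in simp)
  have xs1: "nA (x + s) \<le> nA s + c"
  proof -
    have "x \<bullet> A (x + s) = (nA (x + s))\<^sup>2 - s \<bullet> A (x + s)"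
      by (simp add: nA2 inner_add_left)
    moreover have "s \<bullet> A (x + s) \<le> nA s * nA (x + s)"
    proof (rule power2_le_imp_le)
      show "(s \<bullet> A (x + s))\<^sup>2 \<le> (nA s * nA (x + s))\<^sup>2"
        using semidefinite_Cauchy_Schwarz[OF lin sa subspace_UNIV nonneg, of s "x + s"]
        by (simp add: power_mult_distrib nA2)
    qed (use nA0 in simp)
    ultimately have "nA (x + s) * nA (x + s) \<le> (nA s + c) * nA (x + s)"
      using key by (simp add: power2_eq_square algebra_simps)
    then show ?thesis
      using nA0[of "x + s"] nA0[of s] c0 by (cases "nA (x + s) = 0") auto
  qed
  have x_lo: "sqrt lo * norm u \<le> nA u" for u
    using real_sqrt_le_mono[OF lo(2)[of u]] by (simp add: real_sqrt_mult nA_def)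
  have s1: "nA s \<le> norm q / sqrt lo"
  proof -
    have "(nA s)\<^sup>2 \<le> norm s * norm q" using norm_cauchy_schwarz[of s q] by (simp add: nA2 s)
    then have "sqrt lo * (nA s)\<^sup>2 \<le> (sqrt lo * norm s) * norm q"
      using lo(1) by (simp add: algebra_simps)
    also have "\<dots> \<le> nA s * norm q" by (intro mult_right_mono x_lo) simp
    finally have "nA s * (sqrt lo * nA s) \<le> nA s * norm q"
      by (simp add: power2_eq_square algebra_simps)
    then have "sqrt lo * nA s \<le> norm q"
      using nA0[of s] by (cases "nA s = 0") auto
    then show ?thesis using lo(1) by (simp add: field_simps)
  qed
  \<comment> \<open>The bounds so far have the better constants \<open>1 / lo\<close>, \<open>sqrt (hi / lo) * \<tau>\<close> for \<open>x\<close> and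
    \<open>sqrt (hi / lo) * \<tau>\<close>, \<open>hi * \<tau>\<^sup>2\<close> for \<open>y\<close>; factors \<open>sqrt (hi / lo) \<ge> 1\<close> bring them to the common form.\<close>
  define Q R where "Q = norm q" "R = L2_set r J"
  have QR: "0 \<le> Q" "0 \<le> R" by (simp_all add: Q_R_def)
  have sq: "sqrt lo * sqrt lo = lo" "sqrt hi * sqrt hi = hi" "0 < sqrt lo" "0 < sqrt hi"
    "sqrt lo \<le> sqrt hi"
    using lo(1) hi0 hi(1) by auto
  define a b where "a = sqrt lo" "b = sqrt hi"
  have ab: "a * a = lo" "b * b = hi" "0 < a" "0 < b" "a \<le> b"
    using sq by (simp_all add: a_b_def)
  have total: "nA s + c \<le> Q / a + b * \<tau> * R"
    using s1 by (simp add: c_def Q_R_def a_b_def)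
  have kappa: "sqrt (hi / lo) = b / a" by (simp add: real_sqrt_divide a_b_def)
  have total2: "Q / a + b * \<tau> * R \<le> b * (Q / lo + \<tau> * R)"
  proof -
    have "Q / a = a * (Q / lo)" using ab(3) by (simp add: field_simps flip: ab(1))
    also have "\<dots> \<le> b * (Q / lo)" using ab(5) QR lo(1) by (intro mult_right_mono) auto
    finally show ?thesis by (simp add: algebra_simps)
  qed
  have "a * norm x \<le> b * (Q / lo + \<tau> * R)"
    using x_lo[of x] x1 total total2 by (simp add: a_b_def)
  then show "norm x \<le> sqrt (hi / lo) * (norm q / lo + \<tau> * L2_set r J)"
    unfolding kappa Q_R_def[symmetric] using ab(3) by (simp add: field_simps)
  have X0: "0 \<le> Q / lo + \<tau> * R" using QR \<tau> lo(1) by simp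
  have "L2_set y J \<le> b * \<tau> * (b * (Q / lo + \<tau> * R))"
  proof (rule order_trans[OF y_le[folded a_b_def(2)]])
    show "b * \<tau> * nA (x + s) \<le> b * \<tau> * (b * (Q / lo + \<tau> * R))"
      using ab \<tau> by (intro mult_left_mono order_trans[OF xs1 order_trans[OF total total2]]) simp
  qed
  also have "\<dots> \<le> (b * \<tau> * (b * (Q / lo + \<tau> * R))) * (b / a)"
    using mult_left_mono[of 1 "b / a" "b * \<tau> * (b * (Q / lo + \<tau> * R))"] ab \<tau> X0 by simp
  also have "\<dots> = (b * b * b) * \<tau> / a * (Q / lo + \<tau> * R)" by simp
  also have "b * b * b = hi powr (3/2)"
  proof -
    have "hi powr (3/2) = hi powr (1 + 1/2)" by simp
    also have "\<dots> = hi * sqrt hi" using hi0 unfolding powr_add by (simp add: powr_half_sqrt)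
    finally show ?thesis using ab(2) by (simp add: a_b_def)
  qed
  also have "a = lo powr (1/2)" using lo(1) by (simp add: powr_half_sqrt a_b_def)
  finally show "L2_set y J \<le> hi powr (3/2) * \<tau> / lo powr (1/2) * (norm q / lo + \<tau> * L2_set r J)"
    by (simp add: Q_R_def)
qed

section \<open>Strict derivatives and symmetry of second derivatives\<close>

text \<open>
  The increment is compared with its linearization for two points that both tend to \<open>z\<close>. This is the form
  of differentiability that yields estimates for pairs of parameters with no path between them.
\<close>

definition has_strict_derivative ::
  "('a::real_normed_vector \<Rightarrow> 'b::real_normed_vector) \<Rightarrow> ('a \<Rightarrow> 'b) \<Rightarrow> 'a \<Rightarrow> bool" where
  "has_strict_derivative F F' z \<longleftrightarrow> bounded_linear F' \<and>
     (\<forall>e>0. \<forall>\<^sub>F p in nhds z \<times>\<^sub>F nhds z.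
        norm (F (snd p) - F (fst p) - F' (snd p - fst p)) \<le> e * norm (snd p - fst p))"

lemma has_strict_derivativeD:
  assumes "has_strict_derivative F F' z" "0 < e"
  shows "\<forall>\<^sub>F p in nhds z \<times>\<^sub>F nhds z.
    norm (F (snd p) - F (fst p) - F' (snd p - fst p)) \<le> e * norm (snd p - fst p)"
  using assms unfolding has_strict_derivative_def by blast

lemma has_strict_derivative_eq_on:
  assumes "has_strict_derivative F F' z" "open T" "z \<in> T" "\<And>u. u \<in> T \<Longrightarrow> G u = F u"
  shows "has_strict_derivative G F' z"
proof -
  have "\<forall>\<^sub>F u in nhds z. u \<in> T" using assms(2,3) by (rule eventually_nhds_in_open)
  then have "\<forall>\<^sub>F p in nhds z \<times>\<^sub>F nhds z. fst p \<in> T \<and> snd p \<in> T"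
    unfolding eventually_prod_same by fastforce
  then show ?thesis
    using assms(1) unfolding has_strict_derivative_def
    by (force elim!: eventually_rev_mp simp: assms(4) intro: eventually_mono)
qed

lemma has_strict_derivative_imp_has_derivative:
  assumes "has_strict_derivative F F' z"
  shows "(F has_derivative F') (at z)"
  unfolding has_derivative_at_alt
proof (intro conjI allI impI)
  show "bounded_linear F'" using assms unfolding has_strict_derivative_def by blast
  fix e :: real assume "0 < e"
  from has_strict_derivativeD[OF assms this] obtain Q where Q: "eventually Q (nhds z)"
    "\<And>u w. Q u \<Longrightarrow> Q w \<Longrightarrow> norm (F w - F u - F' (w - u)) \<le> e * norm (w - u)"
    unfolding eventually_prod_same by force
  then obtain d where "d > 0" "\<And>w. dist w z < d \<Longrightarrow> Q w"
    unfolding eventually_nhds_metric by blast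
  then show "\<exists>d>0. \<forall>y. norm (y - z) < d \<longrightarrow> norm (F y - F z - F' (y - z)) \<le> e * norm (y - z)"
    using Q(2) by (metis dist_norm dist_self)
qed

lemma has_strict_derivative_imp_lipschitz:
  assumes "has_strict_derivative F F' z"
  obtains C where "0 \<le> C"
    "\<forall>\<^sub>F p in nhds z \<times>\<^sub>F nhds z. norm (F (snd p) - F (fst p)) \<le> C * norm (snd p - fst p)"
proof
  have bl: "bounded_linear F'" using assms unfolding has_strict_derivative_def by blast
  show "0 \<le> 1 + onorm F'" using onorm_pos_le[OF bl] by simp
  show "\<forall>\<^sub>F p in nhds z \<times>\<^sub>F nhds z.
      norm (F (snd p) - F (fst p)) \<le> (1 + onorm F') * norm (snd p - fst p)"
    using has_strict_derivativeD[OF assms zero_less_one]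
  proof eventually_elim
    case (elim p)
    have "norm (F (snd p) - F (fst p))
        \<le> norm (F (snd p) - F (fst p) - F' (snd p - fst p)) + norm (F' (snd p - fst p))"
      using norm_triangle_sub by (metis add.commute)
    then show ?case using elim onorm[OF bl, of "snd p - fst p"] by (simp add: algebra_simps)
  qed
qed

lemma has_strict_derivative_bounded_linear:
  assumes F: "has_strict_derivative F F' z" and P: "bounded_linear P"
  shows "has_strict_derivative (\<lambda>u. P (F u)) (\<lambda>h. P (F' h)) z"
  unfolding has_strict_derivative_def
proof (intro conjI allI impI)
  show "bounded_linear (\<lambda>h. P (F' h))"
    using F bounded_linear_compose[OF P] unfolding has_strict_derivative_def by blast
  interpret P: bounded_linear P by (rule P)
  obtain K where K: "K > 0" "\<And>x. norm (P x) \<le> norm x * K" using P.pos_bounded by blast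
  fix e :: real assume "0 < e"
  then have "0 < e / K" using K by simp
  from has_strict_derivativeD[OF F this]
  show "\<forall>\<^sub>F p in nhds z \<times>\<^sub>F nhds z.
      norm (P (F (snd p)) - P (F (fst p)) - P (F' (snd p - fst p))) \<le> e * norm (snd p - fst p)"
  proof eventually_elim
    case (elim p)
    have "norm (P (F (snd p) - F (fst p) - F' (snd p - fst p)))
        \<le> norm (F (snd p) - F (fst p) - F' (snd p - fst p)) * K" by (rule K)
    also have "\<dots> \<le> e / K * norm (snd p - fst p) * K"
      using elim K by (intro mult_right_mono) auto
    finally show ?case using K by (simp add: P.diff)
  qed
qed

text \<open>
  A ball is convex, so the mean value inequality applies to \<open>F - F' z\<close>, whose derivative is small near \<open>z\<close>.
\<close>

lemma continuous_derivative_imp_strict: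
  fixes F :: "'a::real_normed_vector \<Rightarrow> 'b::real_normed_vector"
  assumes T: "open T" "z \<in> T"
    and der: "\<And>u. u \<in> T \<Longrightarrow> (F has_derivative blinfun_apply (F' u)) (at u)"
    and cont: "isCont F' z"
  shows "has_strict_derivative F (blinfun_apply (F' z)) z"
  unfolding has_strict_derivative_def
proof (intro conjI allI impI blinfun.bounded_linear_right)
  fix e :: real assume e: "0 < e"
  obtain d1 where d1: "d1 > 0" "ball z d1 \<subseteq> T" using T openE by blast
  obtain d2 where d2: "d2 > 0" "\<And>u. dist u z < d2 \<Longrightarrow> dist (F' u) (F' z) < e"
    using cont e unfolding continuous_at_eps_delta by blast
  define B where "B = ball z (min d1 d2)"
  have BT: "u \<in> T" if "u \<in> B" for u using that d1 by (auto simp: B_def)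
  have zB: "z \<in> B" using d1 d2 by (simp add: B_def)
  have bound: "norm (F w - F u - F' z (w - u)) \<le> e * norm (w - u)" if "u \<in> B" "w \<in> B" for u w
  proof -
    have seg: "u + t *\<^sub>R (w - u) \<in> B" if "t \<in> {0..1}" for t
    proof -
      have "u + t *\<^sub>R (w - u) = (1 - t) *\<^sub>R u + t *\<^sub>R w" by (simp add: algebra_simps)
      also have "\<dots> \<in> B"
        using convexD_alt[OF convex_ball] \<open>u \<in> B\<close> \<open>w \<in> B\<close> that unfolding B_def by auto
      finally show ?thesis .
    qed
    have on: "onorm (blinfun_apply (F' x) - blinfun_apply (F' z)) \<le> e" if "x \<in> B" for x
    proof -
      have "blinfun_apply (F' x) - blinfun_apply (F' z) = blinfun_apply (F' x - F' z)"
        by (rule ext) (simp add: blinfun.diff_left)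
      then show ?thesis
        using d2(2)[of x] that
        by (simp add: B_def dist_norm norm_blinfun.rep_eq norm_minus_commute less_imp_le)
    qed
    have "norm (F w - F u - F' z (w - u)) \<le> norm (w - u) * e"
      by (rule differentiable_bound_linearization[where f' = "\<lambda>x. blinfun_apply (F' x)",
            OF seg has_derivative_at_withinI[OF der[OF BT]] on zB])
    then show ?thesis by (simp add: mult.commute)
  qed
  have "eventually (\<lambda>u. u \<in> B) (nhds z)"
    using zB by (intro eventually_nhds_in_open) (auto simp: B_def)
  then show "\<forall>\<^sub>F p in nhds z \<times>\<^sub>F nhds z.
      norm (F (snd p) - F (fst p) - F' z (snd p - fst p)) \<le> e * norm (snd p - fst p)"
    unfolding eventually_prod_same using bound by auto
qed

text \<open>
  The second difference \<open>\<Delta> h k\<close> is symmetric in \<open>h\<close> and \<open>k\<close>. Applying the mean value inequality to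
  \<open>u \<mapsto> \<phi> (u + k) - \<phi> u\<close> shows that it equals \<open>D2 k h\<close> up to \<open>e * norm h * norm k\<close> for small \<open>h\<close> and
  \<open>k\<close>, and scaling \<open>h\<close> and \<open>k\<close> down removes the smallness restriction.
\<close>

lemma strict_second_derivative_symmetric:
  fixes \<phi> :: "'a::real_normed_vector \<Rightarrow> real" and D :: "'a \<Rightarrow> 'a \<Rightarrow>\<^sub>L real"
  assumes T: "open T" "z \<in> T"
    and der: "\<And>u. u \<in> T \<Longrightarrow> (\<phi> has_derivative blinfun_apply (D u)) (at u)"
    and D2: "has_strict_derivative D D2 z"
  shows "D2 h k = D2 k h"
proof -
  have bl: "bounded_linear D2" using D2 unfolding has_strict_derivative_def by blast
  define \<Delta> where "\<Delta> h k = \<phi> (z + h + k) - \<phi> (z + h) - \<phi> (z + k) + \<phi> z" for h k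
  have sym: "\<Delta> h k = \<Delta> k h" for h k by (simp add: \<Delta>_def algebra_simps)
  have approx: "\<exists>r>0. \<forall>h k. norm h < r \<longrightarrow> norm k < r \<longrightarrow> \<bar>\<Delta> h k - D2 k h\<bar> \<le> e * norm h * norm k"
    if e: "0 < e" for e
  proof -
    from has_strict_derivativeD[OF D2 e] obtain Q where Q: "eventually Q (nhds z)"
      "\<And>u w. Q u \<Longrightarrow> Q w \<Longrightarrow> norm (D w - D u - D2 (w - u)) \<le> e * norm (w - u)"
      unfolding eventually_prod_same by force
    have "eventually (\<lambda>u. Q u \<and> u \<in> T) (nhds z)"
      using Q(1) eventually_nhds_in_open[OF T] by eventually_elim simp
    then obtain r where r: "r > 0" "\<And>u. dist u z < r \<Longrightarrow> Q u \<and> u \<in> T"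
      unfolding eventually_nhds_metric by blast
    have "\<bar>\<Delta> h k - D2 k h\<bar> \<le> e * norm h * norm k" if hk: "norm h < r / 2" "norm k < r / 2" for h k
    proof -
      let ?f = "\<lambda>u. \<phi> (u + k) - \<phi> u - D2 k u"
      let ?f' = "\<lambda>u. blinfun_apply (D (u + k) - D u - D2 k)"
      let ?B = "ball z (r / 2)"
      have near: "dist u z < r" "dist (u + k) z < r" if "u \<in> ?B" for u
      proof -
        have "dist (u + k) z \<le> dist (u + k) u + dist u z" by (rule dist_triangle)
        then show "dist (u + k) z < r" using that hk by (simp add: dist_norm norm_minus_commute)
        show "dist u z < r" using that r(1) by (simp add: dist_commute)
      qed
      have d: "(?f has_derivative ?f' u) (at u within ?B)" if "u \<in> ?B" for u
      proof -
        have 1: "(\<phi> has_derivative D (u + k)) (at (u + k))"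
          using r(2) near[OF that] by (intro der) blast
        have "((\<lambda>u. \<phi> (u + k)) has_derivative D (u + k)) (at u)"
          by (rule has_derivative_compose[of "\<lambda>u. u + k" "\<lambda>h. h" u UNIV \<phi>, OF _ 1])
            (auto intro!: derivative_eq_intros)
        moreover have "(\<phi> has_derivative D u) (at u)"
          using r(2) near[OF that] by (intro der) blast
        ultimately have "(?f has_derivative (\<lambda>v. D (u + k) v - D u v - D2 k v)) (at u)"
          by (intro has_derivative_diff bounded_linear_imp_has_derivative
              blinfun.bounded_linear_right)
        moreover have "?f' u = (\<lambda>v. D (u + k) v - D u v - D2 k v)"
          by (rule ext) (simp only: blinfun.diff_left)
        ultimately show ?thesis
          by (metis has_derivative_at_withinI)
      qed
      have on: "onorm (?f' u) \<le> e * norm k" if "u \<in> ?B" for u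
        using Q(2)[of u "u + k"] r(2) near[OF that] by (simp add: norm_blinfun.rep_eq)
      have "norm (?f (z + h) - ?f z) \<le> e * norm k * norm (z + h - z)"
        by (rule differentiable_bound[OF convex_ball d on]) (use hk r in \<open>auto simp: dist_norm\<close>)
      then show ?thesis
        by (simp add: \<Delta>_def blinfun.add_right algebra_simps)
    qed
    then show ?thesis using r(1) by (intro exI[of _ "r / 2"]) auto
  qed
  have "\<bar>D2 h k - D2 k h\<bar> \<le> e" if e: "0 < e" for e
  proof -
    define c where "c = e / (2 * norm h * norm k + 1)"
    have den: "0 < 2 * norm h * norm k + 1" by (simp add: add_nonneg_pos)
    have c: "0 < c" using e den by (simp add: c_def)
    obtain r where r: "r > 0"
      "\<And>h k. norm h < r \<Longrightarrow> norm k < r \<Longrightarrow> \<bar>\<Delta> h k - D2 k h\<bar> \<le> c * norm h * norm k"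
      using approx[OF c] by blast
    define s where "s = r / (norm h + norm k + 1)"
    have d: "0 < norm h + norm k + 1" by (simp add: add_nonneg_pos)
    have s: "0 < s" using r d by (simp add: s_def)
    have "s * norm h < r" "s * norm k < r"
      using r(1) d by (simp_all add: s_def divide_simps add_nonneg_pos)
    then have sm: "norm (s *\<^sub>R h) < r" "norm (s *\<^sub>R k) < r" using s by simp_all
    define M where "M = s * s * (c * norm h * norm k)"
    have scale: "D2 (s *\<^sub>R u) (s *\<^sub>R v) = s * s * D2 u v" for u v
      by (simp add: linear_simps[OF bl] blinfun.scaleR_left blinfun.scaleR_right)
    have "\<bar>\<Delta> (s *\<^sub>R h) (s *\<^sub>R k) - s * s * D2 k h\<bar> \<le> M"
      using r(2)[OF sm] s unfolding scale by (simp add: M_def algebra_simps)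
    moreover have "\<bar>\<Delta> (s *\<^sub>R h) (s *\<^sub>R k) - s * s * D2 h k\<bar> \<le> M"
      using r(2)[OF sm(2,1)] s unfolding scale sym[of "s *\<^sub>R k"] by (simp add: M_def algebra_simps)
    ultimately have "\<bar>s * s * D2 h k - s * s * D2 k h\<bar> \<le> 2 * M" by linarith
    then have "(s * s) * \<bar>D2 h k - D2 k h\<bar> \<le> (s * s) * (c * (2 * norm h * norm k))"
      unfolding right_diff_distrib[symmetric] abs_mult M_def using s by (simp add: mult.assoc)
    then have "\<bar>D2 h k - D2 k h\<bar> \<le> c * (2 * norm h * norm k)"
      using s by simp
    also have "\<dots> \<le> c * (2 * norm h * norm k + 1)" using c by (intro mult_left_mono) auto
    also have "\<dots> = e" using den by (simp add: c_def)
    finally show ?thesis .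
  qed
  from this[of "\<bar>D2 h k - D2 k h\<bar> / 2"] show ?thesis by (cases "D2 h k = D2 k h") simp_all
qed

section \<open>Twice continuously differentiable functions of two variables\<close>

lemma C2_on_add_scaled:
  assumes "C2_on S \<phi>" "C2_on S \<psi>"
  shows "C2_on S (\<lambda>z. \<phi> z + c * \<psi> z)"
proof -
  obtain T D D2 where 1: "open T" "S \<subseteq> T"
    "\<forall>z\<in>T. (\<phi> has_derivative blinfun_apply (D z)) (at z)"
    "\<forall>z\<in>T. (D has_derivative blinfun_apply (D2 z)) (at z)" "continuous_on T D2"
    using assms(1) unfolding C2_on_def by blast
  obtain T' D' D2' where 2: "open T'" "S \<subseteq> T'"
    "\<forall>z\<in>T'. (\<psi> has_derivative blinfun_apply (D' z)) (at z)"
    "\<forall>z\<in>T'. (D' has_derivative blinfun_apply (D2' z)) (at z)" "continuous_on T' D2'"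
    using assms(2) unfolding C2_on_def by blast
  show ?thesis
    unfolding C2_on_def
  proof (intro exI[of _ "T \<inter> T'"] exI[of _ "\<lambda>z. D z + c *\<^sub>R D' z"]
      exI[of _ "\<lambda>z. D2 z + c *\<^sub>R D2' z"] conjI ballI)
    fix z assume z: "z \<in> T \<inter> T'"
    have "((\<lambda>z. \<phi> z + c * \<psi> z) has_derivative (\<lambda>h. D z h + c * D' z h)) (at z)"
      using z 1 2 by (intro derivative_intros) auto
    then show "((\<lambda>z. \<phi> z + c * \<psi> z) has_derivative (D z + c *\<^sub>R D' z)) (at z)"
      by (simp add: plus_blinfun.rep_eq scaleR_blinfun.rep_eq)
    have "((\<lambda>z. D z + c *\<^sub>R D' z) has_derivative (\<lambda>h. D2 z h + c *\<^sub>R D2' z h)) (at z)"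
      using z 1 2 by (intro derivative_intros) auto
    then show "((\<lambda>z. D z + c *\<^sub>R D' z) has_derivative (D2 z + c *\<^sub>R D2' z)) (at z)"
      by (simp add: plus_blinfun.rep_eq scaleR_blinfun.rep_eq)
  next
    show "continuous_on (T \<inter> T') (\<lambda>z. D2 z + c *\<^sub>R D2' z)"
      using 1(5) 2(5) by (intro continuous_intros) (auto intro: continuous_on_subset)
  qed (use 1 2 in auto)
qed

lemma C2_on_linear_combination:
  assumes "finite K" "C2_on S \<phi>" "\<And>j. j \<in> K \<Longrightarrow> C2_on S (c j)"
  shows "C2_on S (\<lambda>z. \<phi> z + (\<Sum>j\<in>K. y j * c j z))"
  using assms(1,3)
proof (induction K)
  case empty
  then show ?case using assms(2) by simp
next
  case (insert j K)
  then have "C2_on S (\<lambda>z. \<phi> z + (\<Sum>j\<in>K. y j * c j z) + y j * c j z)"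
    by (intro C2_on_add_scaled) auto
  then show ?case using insert by (simp add: algebra_simps)
qed

lemma gradient_eq:
  fixes \<psi> :: "'a::real_inner \<Rightarrow> real"
  assumes "(\<psi> has_derivative d) (at z)" "\<And>h. d h = a \<bullet> h"
  shows "gradient \<psi> z = a"
  unfolding gradient_def
proof (rule the_equality)
  have "d = (\<lambda>h. h \<bullet> a)" using assms(2) by (auto simp: inner_commute)
  then show 1: "GDERIV \<psi> z :> a" using assms(1) by (simp add: gderiv_def)
  fix b assume "GDERIV \<psi> z :> b"
  with 1 have "(\<lambda>h. h \<bullet> b) = (\<lambda>h. h \<bullet> a)"
    unfolding gderiv_def by (rule has_derivative_unique[rotated])
  then have "(b - a) \<bullet> b = (b - a) \<bullet> a" by metis
  then have "(b - a) \<bullet> (b - a) = 0" by (simp add: inner_diff_right)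
  then show "b = a" by simp
qed

lemma jacobian_eq:
  fixes F :: "real^'a \<Rightarrow> real^'b"
  assumes "(F has_derivative d) (at z)"
  shows "jacobian F (at z) *v h = d h"
  using assms jacobian_works[of F "at z"] has_derivative_unique[of F d z]
  by (metis differentiableI)

text \<open>
  On the open set \<open>T\<close> where the joint derivative \<open>D\<close> exists, the partial gradient is the image of \<open>D\<close> under
  the fixed bounded linear map \<open>Px\<close> that represents \<open>h \<mapsto> d (h, 0)\<close> by a vector. So it inherits the strict
  derivative of \<open>D\<close>, and the two Jacobians are the restrictions of this derivative to the factors. Since
  \<open>T\<close> is open, these derivatives are determined also at parameters that are not interior to \<open>\<Xi>\<close>.
\<close>

lemma C2_on_partial_derivatives:
  fixes \<phi> :: "real^'n \<Rightarrow> real^'r \<Rightarrow> real"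
  assumes C2: "C2_on (UNIV \<times> \<Xi>) (\<lambda>(x, \<xi>). \<phi> x \<xi>)" and \<xi>: "\<xi> \<in> \<Xi>"
  shows has_derivative_grad_x: "((\<lambda>u. \<phi> u \<xi>) has_derivative (\<lambda>h. grad_x \<phi> x \<xi> \<bullet> h)) (at x)"
    and strict_derivative_function: "has_strict_derivative (\<lambda>z. \<phi> (fst z) (snd z))
      (\<lambda>h. grad_x \<phi> x \<xi> \<bullet> fst h + grad_xi \<phi> x \<xi> \<bullet> snd h) (x, \<xi>)"
    and strict_derivative_grad_x: "has_strict_derivative (\<lambda>z. grad_x \<phi> (fst z) (snd z))
      (\<lambda>h. hess_xx \<phi> x \<xi> *v fst h + hess_xi_x \<phi> x \<xi> *v snd h) (x, \<xi>)"
    and hess_xx_selfadjoint: "(hess_xx \<phi> x \<xi> *v u) \<bullet> v = u \<bullet> (hess_xx \<phi> x \<xi> *v v)"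
proof -
  let ?\<phi> = "\<lambda>z. \<phi> (fst z) (snd z)"
  obtain T D D2 where T: "open T" "UNIV \<times> \<Xi> \<subseteq> T"
    and D: "\<And>z. z \<in> T \<Longrightarrow> (?\<phi> has_derivative blinfun_apply (D z)) (at z)"
    and D2: "\<And>z. z \<in> T \<Longrightarrow> (D has_derivative blinfun_apply (D2 z)) (at z)"
    and cont: "continuous_on T D2"
    using C2 unfolding C2_on_def case_prod_beta by blast
  have zT: "(x, \<xi>) \<in> T" using T \<xi> by auto
  define Px where "Px d = (\<Sum>b\<in>Basis. blinfun_apply d (b, 0) *\<^sub>R b)" for d :: "((real^'n) \<times> (real^'r)) \<Rightarrow>\<^sub>L real"
  have Px: "Px d \<bullet> h = d (h, 0)" for d h
  proof -
    have lin: "linear (\<lambda>h. blinfun_apply d (h, 0))"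
      by (intro bounded_linear.linear bounded_linear_intros)
    have "d (h, 0) = d ((\<Sum>b\<in>Basis. (h \<bullet> b) *\<^sub>R b), 0)" by (simp add: euclidean_representation)
    also have "\<dots> = (\<Sum>b\<in>Basis. (h \<bullet> b) * d (b, 0))"
      using linear_sum[OF lin, of "\<lambda>b. (h \<bullet> b) *\<^sub>R b" Basis] linear_cmul[OF lin] by simp
    finally show ?thesis by (simp add: Px_def inner_sum_right inner_commute[of _ h] mult.commute)
  qed
  have blPx: "bounded_linear Px"
    unfolding Px_def by (intro bounded_linear_intros)
  have incl_x: "((\<lambda>u. (u, \<zeta>)) has_derivative (\<lambda>h. (h, 0))) (at w)"
    for w :: "real^'n" and \<zeta> :: "real^'r"
    by (auto intro!: derivative_eq_intros)
  have incl_xi: "((\<lambda>\<zeta>. (w, \<zeta>)) has_derivative (\<lambda>h. (0, h))) (at \<zeta>)"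
    for w :: "real^'n" and \<zeta> :: "real^'r"
    by (auto intro!: derivative_eq_intros)
  have part_x: "((\<lambda>u. \<phi> u \<zeta>) has_derivative (\<lambda>h. D (w, \<zeta>) (h, 0))) (at w)" if "(w, \<zeta>) \<in> T" for w \<zeta>
    using has_derivative_compose[OF incl_x D[OF that]] by simp
  have gx: "grad_x \<phi> w \<zeta> = Px (D (w, \<zeta>))" if "(w, \<zeta>) \<in> T" for w \<zeta>
    unfolding grad_x_def by (rule gradient_eq[OF part_x[OF that]]) (simp add: Px)
  have gx_inner: "grad_x \<phi> x \<xi> \<bullet> h = D (x, \<xi>) (h, 0)" for h
    by (simp add: gx[OF zT] Px)
  show "((\<lambda>u. \<phi> u \<xi>) has_derivative (\<lambda>h. grad_x \<phi> x \<xi> \<bullet> h)) (at x)"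
    using part_x[OF zT] by (simp add: gx_inner)
  have part_xi: "((\<lambda>\<zeta>. \<phi> x \<zeta>) has_derivative (\<lambda>h. D (x, \<xi>) (0, h))) (at \<xi>)"
    using has_derivative_compose[OF incl_xi D[OF zT]] by simp
  have lin_xi: "linear (\<lambda>h. D (x, \<xi>) (0, h))"
    by (intro bounded_linear.linear bounded_linear_intros)
  define a where "a = adjoint (\<lambda>h. D (x, \<xi>) (0, h)) 1"
  have a: "D (x, \<xi>) (0, h) = a \<bullet> h" for h
    using adjoint_works[OF lin_xi, of h 1] by (simp add: a_def inner_commute[of _ h])
  have gxi_inner: "grad_xi \<phi> x \<xi> \<bullet> h = D (x, \<xi>) (0, h)" for h
    using gradient_eq[OF part_xi a] by (simp only: grad_xi_def a)
  have "isCont D (x, \<xi>)" using D2[OF zT] by (rule has_derivative_continuous)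
  from continuous_derivative_imp_strict[OF T(1) zT D this]
  have "has_strict_derivative ?\<phi> (blinfun_apply (D (x, \<xi>))) (x, \<xi>)" .
  moreover have "blinfun_apply (D (x, \<xi>)) = (\<lambda>h. grad_x \<phi> x \<xi> \<bullet> fst h + grad_xi \<phi> x \<xi> \<bullet> snd h)"
  proof
    fix h :: "(real^'n) \<times> (real^'r)"
    have "D (x, \<xi>) h = D (x, \<xi>) ((fst h, 0) + (0, snd h))" by simp
    then show "D (x, \<xi>) h = grad_x \<phi> x \<xi> \<bullet> fst h + grad_xi \<phi> x \<xi> \<bullet> snd h"
      unfolding gx_inner gxi_inner blinfun.add_right .
  qed
  ultimately show "has_strict_derivative ?\<phi>
      (\<lambda>h. grad_x \<phi> x \<xi> \<bullet> fst h + grad_xi \<phi> x \<xi> \<bullet> snd h) (x, \<xi>)" by simp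
  have "isCont D2 (x, \<xi>)" using cont T(1) zT by (simp add: continuous_on_eq_continuous_at)
  from continuous_derivative_imp_strict[OF T(1) zT D2 this]
  have strictD: "has_strict_derivative D (D2 (x, \<xi>)) (x, \<xi>)" .
  have strict: "has_strict_derivative (\<lambda>z. grad_x \<phi> (fst z) (snd z)) (\<lambda>h. Px (D2 (x, \<xi>) h)) (x, \<xi>)"
    by (rule has_strict_derivative_eq_on[OF has_strict_derivative_bounded_linear[OF strictD blPx]
          T(1) zT]) (simp add: gx)
  note der = has_strict_derivative_imp_has_derivative[OF strict]
  have "((\<lambda>u. grad_x \<phi> u \<xi>) has_derivative (\<lambda>h. Px (D2 (x, \<xi>) (h, 0)))) (at x)"
    using has_derivative_compose[OF incl_x der] by simp
  from jacobian_eq[OF this] have hxx: "hess_xx \<phi> x \<xi> *v h = Px (D2 (x, \<xi>) (h, 0))" for h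
    by (simp add: hess_xx_def)
  have "((\<lambda>\<zeta>. grad_x \<phi> x \<zeta>) has_derivative (\<lambda>h. Px (D2 (x, \<xi>) (0, h)))) (at \<xi>)"
    using has_derivative_compose[OF incl_xi der] by simp
  from jacobian_eq[OF this] have hxi: "hess_xi_x \<phi> x \<xi> *v h = Px (D2 (x, \<xi>) (0, h))" for h
    by (simp add: hess_xi_x_def)
  have "Px (D2 (x, \<xi>) h) = hess_xx \<phi> x \<xi> *v fst h + hess_xi_x \<phi> x \<xi> *v snd h" for h
  proof -
    have "Px (D2 (x, \<xi>) h) = Px (D2 (x, \<xi>) ((fst h, 0) + (0, snd h)))" by simp
    then show ?thesis
      unfolding hxx hxi blinfun.add_right linear_simps(1)[OF blPx] .
  qed
  then show "has_strict_derivative (\<lambda>z. grad_x \<phi> (fst z) (snd z))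
      (\<lambda>h. hess_xx \<phi> x \<xi> *v fst h + hess_xi_x \<phi> x \<xi> *v snd h) (x, \<xi>)"
    using strict by simp
  show "(hess_xx \<phi> x \<xi> *v u) \<bullet> v = u \<bullet> (hess_xx \<phi> x \<xi> *v v)"
    using strict_second_derivative_symmetric[OF T(1) zT D strictD, of "(u, 0)" "(v, 0)"]
    by (simp add: hxx Px inner_commute[of u])
qed

section \<open>Error terms along pairs of parameters\<close>

lemma eventually_pair_filterlim:
  assumes "eventually P (G \<times>\<^sub>F G)" "filterlim z G F"
  shows "\<forall>\<^sub>F p in F \<times>\<^sub>F F. P (z (fst p), z (snd p))"
proof -
  obtain Q where Q: "eventually Q G" "\<And>u w. Q u \<Longrightarrow> Q w \<Longrightarrow> P (u, w)"
    using assms(1) unfolding eventually_prod_same by blast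
  have "\<forall>\<^sub>F \<xi> in F. Q (z \<xi>)" using assms(2) Q(1) unfolding filterlim_iff by blast
  then show ?thesis unfolding eventually_prod_same using Q(2) by force
qed

lemma eventually_pair_both:
  assumes "eventually P F"
  shows "\<forall>\<^sub>F p in F \<times>\<^sub>F F. P (fst p) \<and> P (snd p)"
  unfolding eventually_prod_same using assms by force

text \<open>
  Subtracting the stationarity conditions at two parameters leaves the increment of \<open>\<Phi>\<close>, the multiplier
  increments times \<open>\<gamma> j\<close> at the second point, and the products of \<open>y j - y0 j\<close> at the first point with the
  increment of \<open>\<gamma> j\<close>. The last group is of higher order because the multipliers are close to \<open>y0\<close> and
  \<open>\<gamma> j\<close> is Lipschitz; in the second, \<open>\<gamma> j\<close> may be replaced by its value at \<open>z0\<close>.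
\<close>

lemma stationarity_expansion:
  fixes \<Phi> :: "'z::real_normed_vector \<Rightarrow> 'a::real_normed_vector"
  assumes fin: "finite J"
    and \<Phi>: "has_strict_derivative \<Phi> \<Phi>' z0"
    and \<gamma>: "\<And>j. j \<in> J \<Longrightarrow> has_strict_derivative (\<gamma> j) (\<gamma>' j) z0"
    and z: "(z \<longlongrightarrow> z0) F" and y: "\<And>j. j \<in> J \<Longrightarrow> ((\<lambda>\<xi>. y \<xi> j) \<longlongrightarrow> y0 j) F"
    and stat: "\<forall>\<^sub>F \<xi> in F. \<Phi> (z \<xi>) + (\<Sum>j\<in>J. (y \<xi> j - y0 j) *\<^sub>R \<gamma> j (z \<xi>)) = 0"
    and e: "0 < e"
  shows "\<forall>\<^sub>F p in F \<times>\<^sub>F F.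
    norm (\<Phi>' (z (snd p) - z (fst p)) + (\<Sum>j\<in>J. (y (snd p) j - y (fst p) j) *\<^sub>R \<gamma> j z0))
      \<le> e * (norm (z (snd p) - z (fst p)) + L2_set (\<lambda>j. y (snd p) j - y (fst p) j) J)"
proof -
  have "\<forall>j\<in>J. \<exists>C. 0 \<le> C \<and> (\<forall>\<^sub>F p in nhds z0 \<times>\<^sub>F nhds z0.
      norm (\<gamma> j (snd p) - \<gamma> j (fst p)) \<le> C * norm (snd p - fst p))"
  proof
    fix j assume "j \<in> J"
    show "\<exists>C. 0 \<le> C \<and> (\<forall>\<^sub>F p in nhds z0 \<times>\<^sub>F nhds z0.
        norm (\<gamma> j (snd p) - \<gamma> j (fst p)) \<le> C * norm (snd p - fst p))"
      by (rule has_strict_derivative_imp_lipschitz[OF \<gamma>[OF \<open>j \<in> J\<close>]]) (intro exI conjI)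
  qed
  from bchoice[OF this] obtain C where C: "\<And>j. j \<in> J \<Longrightarrow> 0 \<le> C j" "\<And>j. j \<in> J \<Longrightarrow> \<forall>\<^sub>F p in nhds z0 \<times>\<^sub>F nhds z0.
      norm (\<gamma> j (snd p) - \<gamma> j (fst p)) \<le> C j * norm (snd p - fst p)"
    by blast
  define c where "c = 1 + card J + sum C J"
  have c1: "1 + sum C J \<le> c" "card J \<le> c" "0 < c"
    using sum_nonneg[of J C] C(1) by (auto simp: c_def)
  define d where "d = e / c"
  have d: "0 < d" "d * c = e" using e c1 by (simp_all add: d_def)
  have ev\<Phi>: "\<forall>\<^sub>F p in F \<times>\<^sub>F F. norm (\<Phi> (z (snd p)) - \<Phi> (z (fst p)) - \<Phi>' (z (snd p) - z (fst p)))
      \<le> d * norm (z (snd p) - z (fst p))"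
    using eventually_pair_filterlim[OF has_strict_derivativeD[OF \<Phi> d(1)] z] by simp
  have ev\<gamma>: "\<forall>\<^sub>F p in F \<times>\<^sub>F F. \<forall>j\<in>J. norm (\<gamma> j (z (snd p)) - \<gamma> j (z (fst p)))
      \<le> C j * norm (z (snd p) - z (fst p))"
    using eventually_pair_filterlim[OF C(2) z] fin by (simp add: eventually_ball_finite)
  have "\<forall>\<^sub>F \<xi> in F. \<bar>y \<xi> j - y0 j\<bar> < d \<and> norm (\<gamma> j (z \<xi>) - \<gamma> j z0) < d" if j: "j \<in> J" for j
  proof -
    have "isCont (\<gamma> j) z0"
      using has_strict_derivative_imp_has_derivative[OF \<gamma>[OF j]] by (rule has_derivative_continuous)
    then have "((\<lambda>\<xi>. \<gamma> j (z \<xi>)) \<longlongrightarrow> \<gamma> j z0) F" using z by (rule isCont_tendsto_compose)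
    from tendstoD[OF this d(1)] tendstoD[OF y[OF j] d(1)] show ?thesis
      by eventually_elim (simp add: dist_norm)
  qed
  then have "\<forall>\<^sub>F \<xi> in F. \<forall>j\<in>J. \<bar>y \<xi> j - y0 j\<bar> < d \<and> norm (\<gamma> j (z \<xi>) - \<gamma> j z0) < d"
    using fin by (simp add: eventually_ball_finite)
  from eventually_pair_both[OF this] eventually_pair_both[OF stat] ev\<Phi> ev\<gamma>
  show ?thesis
  proof eventually_elim
    case (elim p)
    define z1 z2 where "z1 = z (fst p)" "z2 = z (snd p)"
    define y1 y2 where "y1 = y (fst p)" "y2 = y (snd p)"
    note defs = z1_z2_def[symmetric] y1_y2_def[symmetric]
    let ?n = "norm (z2 - z1)" and ?l = "L2_set (\<lambda>j. y2 j - y1 j) J"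
    have close: "\<bar>y1 j - y0 j\<bar> \<le> d" "norm (\<gamma> j z2 - \<gamma> j z0) \<le> d" if "j \<in> J" for j
      using elim(1) that unfolding defs by (auto intro: less_imp_le)
    have st: "\<Phi> z1 = - (\<Sum>j\<in>J. (y1 j - y0 j) *\<^sub>R \<gamma> j z1)" "\<Phi> z2 = - (\<Sum>j\<in>J. (y2 j - y0 j) *\<^sub>R \<gamma> j z2)"
      using elim(2) unfolding defs by (simp_all add: eq_neg_iff_add_eq_0)
    have tri: "norm (- u - v - w) \<le> norm u + norm v + norm w" for u v w :: 'a
      using norm_triangle_ineq4[of "- u - v" w] norm_triangle_ineq4[of "- u" v] by simp
    have "\<Phi> z2 - \<Phi> z1
        = - (\<Sum>j\<in>J. (y2 j - y1 j) *\<^sub>R \<gamma> j z2) - (\<Sum>j\<in>J. (y1 j - y0 j) *\<^sub>R (\<gamma> j z2 - \<gamma> j z1))"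
      unfolding st by (simp add: algebra_simps sum.distrib sum_subtractf)
    then have "\<Phi>' (z2 - z1) + (\<Sum>j\<in>J. (y2 j - y1 j) *\<^sub>R \<gamma> j z0)
        = - (\<Phi> z2 - \<Phi> z1 - \<Phi>' (z2 - z1)) - (\<Sum>j\<in>J. (y2 j - y1 j) *\<^sub>R (\<gamma> j z2 - \<gamma> j z0))
          - (\<Sum>j\<in>J. (y1 j - y0 j) *\<^sub>R (\<gamma> j z2 - \<gamma> j z1))"
      by (simp add: algebra_simps sum.distrib sum_subtractf)
    also have "norm \<dots> \<le> norm (\<Phi> z2 - \<Phi> z1 - \<Phi>' (z2 - z1))
        + norm (\<Sum>j\<in>J. (y2 j - y1 j) *\<^sub>R (\<gamma> j z2 - \<gamma> j z0))
        + norm (\<Sum>j\<in>J. (y1 j - y0 j) *\<^sub>R (\<gamma> j z2 - \<gamma> j z1))"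
      by (rule tri)
    also have "\<dots> \<le> d * ?n + card J * (d * ?l) + d * sum C J * ?n"
    proof (intro add_mono)
      show "norm (\<Phi> z2 - \<Phi> z1 - \<Phi>' (z2 - z1)) \<le> d * ?n" using elim(3) unfolding defs .
      show "norm (\<Sum>j\<in>J. (y2 j - y1 j) *\<^sub>R (\<gamma> j z2 - \<gamma> j z0)) \<le> card J * (d * ?l)"
      proof (rule order_trans[OF norm_sum sum_bounded_above[THEN order_trans]])
        fix j assume j: "j \<in> J"
        have "\<bar>y2 j - y1 j\<bar> \<le> ?l"
          using member_le_L2_set[OF fin j, of "\<lambda>j. \<bar>y2 j - y1 j\<bar>"] by (simp add: L2_set_def)
        then have "\<bar>y2 j - y1 j\<bar> * norm (\<gamma> j z2 - \<gamma> j z0) \<le> ?l * d"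
          using close[OF j] by (intro mult_mono) auto
        then show "norm ((y2 j - y1 j) *\<^sub>R (\<gamma> j z2 - \<gamma> j z0)) \<le> d * ?l"
          by (simp add: mult.commute)
      qed simp
      show "norm (\<Sum>j\<in>J. (y1 j - y0 j) *\<^sub>R (\<gamma> j z2 - \<gamma> j z1)) \<le> d * sum C J * ?n"
      proof -
        have "norm (\<Sum>j\<in>J. (y1 j - y0 j) *\<^sub>R (\<gamma> j z2 - \<gamma> j z1)) \<le> (\<Sum>j\<in>J. d * (C j * ?n))"
        proof (rule order_trans[OF norm_sum sum_mono])
          fix j assume j: "j \<in> J"
          have "norm (\<gamma> j z2 - \<gamma> j z1) \<le> C j * ?n" using elim(4) j unfolding defs by blast
          then show "norm ((y1 j - y0 j) *\<^sub>R (\<gamma> j z2 - \<gamma> j z1)) \<le> d * (C j * ?n)"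
            using close[OF j] d by (simp add: mult_mono)
        qed
        then show ?thesis by (simp add: sum_distrib_left sum_distrib_right mult.assoc)
      qed
    qed
    also have "\<dots> = d * (1 + sum C J) * ?n + d * card J * ?l" by (simp add: algebra_simps)
    also have "\<dots> \<le> d * c * ?n + d * c * ?l"
      using c1 d by (intro add_mono mult_right_mono mult_left_mono) auto
    also have "\<dots> = e * (?n + ?l)" unfolding d(2) by (simp add: algebra_simps)
    finally show ?case unfolding defs .
  qed
qed

lemma family_expansion:
  fixes c :: "'j \<Rightarrow> 'z::real_normed_vector \<Rightarrow> real"
  assumes fin: "finite J" and c: "\<And>j. j \<in> J \<Longrightarrow> has_strict_derivative (c j) (c' j) z0"
    and z: "(z \<longlongrightarrow> z0) F" and e: "0 < e"
  shows "\<forall>\<^sub>F p in F \<times>\<^sub>F F.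
    L2_set (\<lambda>j. c j (z (snd p)) - c j (z (fst p)) - c' j (z (snd p) - z (fst p))) J
      \<le> e * norm (z (snd p) - z (fst p))"
proof -
  define d where "d = e / (1 + card J)"
  have d: "0 < d" "card J * d \<le> e" using e by (simp_all add: d_def divide_simps)
  have "\<forall>\<^sub>F p in F \<times>\<^sub>F F. \<forall>j\<in>J.
      norm (c j (z (snd p)) - c j (z (fst p)) - c' j (z (snd p) - z (fst p)))
        \<le> d * norm (z (snd p) - z (fst p))"
    using eventually_pair_filterlim[OF has_strict_derivativeD[OF c d(1)] z] fin
    by (simp add: eventually_ball_finite)
  then show ?thesis
  proof eventually_elim
    case (elim p)
    let ?n = "norm (z (snd p) - z (fst p))"
    have "L2_set (\<lambda>j. c j (z (snd p)) - c j (z (fst p)) - c' j (z (snd p) - z (fst p))) J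
        \<le> (\<Sum>j\<in>J. \<bar>c j (z (snd p)) - c j (z (fst p)) - c' j (z (snd p) - z (fst p))\<bar>)"
      by (rule L2_set_le_sum_abs)
    also have "\<dots> \<le> card J * (d * ?n)"
      using elim by (intro sum_bounded_above) auto
    also have "\<dots> \<le> e * ?n" using mult_right_mono[OF d(2), of ?n] by (simp add: mult.assoc)
    finally show ?case .
  qed
qed

text \<open>
  The linearization errors are small multiples of the total change \<open>a + b + \<delta>\<close>, which contains the
  unknown changes \<open>a\<close> and \<open>b\<close>. Since these are controlled by \<open>X\<close>, the errors move to the left-hand side, at
  the price of an arbitrarily small increase from \<open>K\<close> to \<open>k\<close>.
\<close>

lemma absorb_relative_error:
  fixes M\<^sub>1 M\<^sub>2 K c k :: real
  assumes "0 \<le> M\<^sub>1" "0 \<le> M\<^sub>2" "0 \<le> K" "0 \<le> c" "K < k"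
  obtains e where "0 < e" "\<And>a b \<delta> X. a \<le> M\<^sub>1 * X \<Longrightarrow> b \<le> M\<^sub>2 * X \<Longrightarrow> 0 \<le> \<delta> \<Longrightarrow>
    X \<le> K * \<delta> + e * c * (a + b + \<delta>) \<Longrightarrow> X \<le> k * \<delta>"
proof -
  define M where "M = M\<^sub>1 + M\<^sub>2"
  \<comment> \<open>\<open>e\<close> is chosen so that \<open>e * s \<le> (k - K) / 2\<close>; the \<open>+ 1\<close> covers \<open>s = 0\<close>.\<close>
  define s where "s = c * (1 + M * k)"
  define e where "e = (k - K) / (2 * (s + 1))"
  have M: "0 \<le> M" and k: "0 < k" using assms by (simp_all add: M_def)
  have s: "0 \<le> s" using assms M k by (simp add: s_def)
  have e: "0 < e" using assms s by (simp add: e_def)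
  have "e * s \<le> e * (s + 1)" using e by simp
  also have "\<dots> = (k - K) / 2" unfolding e_def using s by (simp add: field_simps)
  finally have es: "e * c + e * c * M * k \<le> (k - K) / 2" by (simp add: s_def algebra_simps)
  have "0 \<le> e * c" using e assms by simp
  moreover have "(k - K) / 2 < k" using k assms(3) by simp
  ultimately have "0 < (1 - e * c * M) * k" using es by (simp add: algebra_simps)
  then have q: "0 < 1 - e * c * M" using k by (rule zero_less_mult_pos2)
  show ?thesis
  proof (rule that[OF e])
    fix a b \<delta> X :: real
    assume a: "a \<le> M\<^sub>1 * X" "b \<le> M\<^sub>2 * X" "0 \<le> \<delta>" "X \<le> K * \<delta> + e * c * (a + b + \<delta>)"
    have "e * c * (a + b + \<delta>) \<le> e * c * (M * X + \<delta>)"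
      using a \<open>0 \<le> e * c\<close> by (intro mult_left_mono) (auto simp: M_def algebra_simps)
    with a(4) have "(1 - e * c * M) * X \<le> (K + e * c) * \<delta>" by (simp add: algebra_simps)
    also have "\<dots> \<le> (k * (1 - e * c * M)) * \<delta>"
      using es assms a(3) by (intro mult_right_mono) (auto simp: algebra_simps)
    finally have "(1 - e * c * M) * X \<le> (1 - e * c * M) * (k * \<delta>)" by (simp add: algebra_simps)
    then show "X \<le> k * \<delta>" using q by simp
  qed
qed

lemma locally_lipschitz_atI_scaled:
  assumes M: "0 \<le> M"
    and ev: "\<And>k. K < k \<Longrightarrow> \<forall>\<^sub>F p in inf (nhds z) (principal S) \<times>\<^sub>F inf (nhds z) (principal S).
      d (F (fst p)) (F (snd p)) \<le> M * (k * norm (snd p - fst p))"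
  shows "locally_lipschitz_at d (M * K) S F z"
  unfolding locally_lipschitz_at_def
proof (intro allI impI)
  fix k assume k: "M * K < k"
  \<comment> \<open>Dividing by \<open>M + 1\<close> rather than \<open>M\<close> covers \<open>M = 0\<close>.\<close>
  define k' where "k' = K + (k - M * K) / (M + 1)"
  have k': "K < k'" using k M by (simp add: k'_def)
  have "M / (M + 1) * (k - M * K) \<le> 1 * (k - M * K)"
    using k M by (intro mult_right_mono) auto
  then have Mk: "M * k' \<le> k" by (simp add: k'_def algebra_simps)
  obtain Q where Q: "eventually Q (inf (nhds z) (principal S))"
    "\<And>u w. Q u \<Longrightarrow> Q w \<Longrightarrow> d (F u) (F w) \<le> M * (k' * norm (w - u))"
    using ev[OF k'] unfolding eventually_prod_same by force
  then obtain V where V: "open V" "z \<in> V" "\<And>u. u \<in> V \<Longrightarrow> u \<in> S \<Longrightarrow> Q u"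
    unfolding eventually_inf_principal eventually_nhds by blast
  have "d (F u) (F w) \<le> k * norm (u - w)" if "u \<in> S \<inter> V" "w \<in> S \<inter> V" for u w
  proof -
    have "d (F u) (F w) \<le> M * (k' * norm (w - u))" using Q(2) V(3) that by blast
    also have "\<dots> \<le> k * norm (u - w)"
      using mult_right_mono[OF Mk, of "norm (u - w)"] by (simp add: norm_minus_commute mult.assoc)
    finally show ?thesis .
  qed
  then show "\<exists>V. open V \<and> z \<in> V \<and>
      (\<forall>y\<in>S \<inter> V. \<forall>w\<in>S \<inter> V. d (F y) (F w) \<le> k * norm (y - w))"
    using V by blast
qed

section \<open>Lagrangians and KKT points\<close>

lemma lagrangian_eq_sum:
  "lagrangian f p h m g l \<mu> x \<xi>
    = f x \<xi> + (\<Sum>j\<in>{..<p} <+> {..<m}. case_sum l \<mu> j * case_sum h g j x \<xi>)"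
  by (simp add: lagrangian_def sum.Plus)

lemma C2_on_lagrangian:
  assumes "C2_on S (\<lambda>(x, \<xi>). f x \<xi>)"
    and "\<And>j. j \<in> {..<p} <+> {..<m} \<Longrightarrow> C2_on S (\<lambda>(x, \<xi>). case_sum h g j x \<xi>)"
  shows "C2_on S (\<lambda>(x, \<xi>). lagrangian f p h m g l \<mu> x \<xi>)"
proof -
  have "C2_on S (\<lambda>z. f (fst z) (snd z)
      + (\<Sum>j\<in>{..<p} <+> {..<m}. case_sum l \<mu> j * case_sum h g j (fst z) (snd z)))"
    using assms unfolding case_prod_beta' by (intro C2_on_linear_combination) auto
  then show ?thesis by (simp add: lagrangian_eq_sum case_prod_beta')
qed

lemma grad_x_lagrangian:
  fixes f :: "real^'n \<Rightarrow> real^'r \<Rightarrow> real"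
  assumes "C2_on (UNIV \<times> \<Xi>) (\<lambda>(x, \<xi>). f x \<xi>)"
    and "\<And>j. j \<in> {..<p} <+> {..<m} \<Longrightarrow> C2_on (UNIV \<times> \<Xi>) (\<lambda>(x, \<xi>). case_sum h g j x \<xi>)"
    and "\<xi> \<in> \<Xi>"
  shows "grad_x (lagrangian f p h m g l \<mu>) x \<xi>
    = grad_x f x \<xi> + (\<Sum>j\<in>{..<p} <+> {..<m}. case_sum l \<mu> j *\<^sub>R constr_grad_x h g x \<xi> j)"
  unfolding grad_x_def[of "lagrangian f p h m g l \<mu>"] lagrangian_eq_sum constr_grad_x_def
proof (rule gradient_eq)
  show "((\<lambda>u. f u \<xi> + (\<Sum>j\<in>{..<p} <+> {..<m}. case_sum l \<mu> j * case_sum h g j u \<xi>)) has_derivative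
      (\<lambda>v. grad_x f x \<xi> \<bullet> v
        + (\<Sum>j\<in>{..<p} <+> {..<m}. case_sum l \<mu> j * (grad_x (case_sum h g j) x \<xi> \<bullet> v)))) (at x)"
    by (intro has_derivative_add has_derivative_sum has_derivative_mult_right
        has_derivative_grad_x[OF _ assms(3)] assms)
qed (simp add: inner_add_left inner_sum_left)

text \<open>
  By complementary slackness the product is \<open>- \<mu>\<^sub>2 g\<^sub>1 - \<mu>\<^sub>1 g\<^sub>2\<close> for an inequality constraint, and both
  terms are nonnegative, whatever the active constraints at the two points are. For an equality constraint
  the second factor vanishes.
\<close>

lemma KKT_monotone:
  assumes "KKT f p h m g \<xi>\<^sub>1 x\<^sub>1 l\<^sub>1 \<mu>\<^sub>1" "KKT f p h m g \<xi>\<^sub>2 x\<^sub>2 l\<^sub>2 \<mu>\<^sub>2"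
    and "j \<in> {..<p} <+> {..<m}"
  shows "0 \<le> (case_sum l\<^sub>2 \<mu>\<^sub>2 j - case_sum l\<^sub>1 \<mu>\<^sub>1 j)
    * (case_sum h g j x\<^sub>2 \<xi>\<^sub>2 - case_sum h g j x\<^sub>1 \<xi>\<^sub>1)"
proof (cases j)
  case (Inl i)
  then have "h i x\<^sub>1 \<xi>\<^sub>1 = 0" "h i x\<^sub>2 \<xi>\<^sub>2 = 0"
    using assms by (auto simp: KKT_def feasible_def)
  then show ?thesis using Inl by simp
next
  case (Inr i)
  then have i: "i < m" using assms(3) by auto
  have le: "g i x\<^sub>1 \<xi>\<^sub>1 \<le> 0" "g i x\<^sub>2 \<xi>\<^sub>2 \<le> 0" "0 \<le> \<mu>\<^sub>1 i" "0 \<le> \<mu>\<^sub>2 i"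
    using assms i by (auto simp: KKT_def feasible_def)
  have "\<mu>\<^sub>1 i * g i x\<^sub>1 \<xi>\<^sub>1 = 0" "\<mu>\<^sub>2 i * g i x\<^sub>2 \<xi>\<^sub>2 = 0"
    using assms i le by (fastforce simp: KKT_def)+
  then have "(\<mu>\<^sub>2 i - \<mu>\<^sub>1 i) * (g i x\<^sub>2 \<xi>\<^sub>2 - g i x\<^sub>1 \<xi>\<^sub>1) = \<mu>\<^sub>2 i * - g i x\<^sub>1 \<xi>\<^sub>1 + \<mu>\<^sub>1 i * - g i x\<^sub>2 \<xi>\<^sub>2"
    by (auto simp: algebra_simps)
  also have "0 \<le> \<dots>" using le by (intro add_nonneg_nonneg mult_nonneg_nonneg) auto
  finally show ?thesis using Inr by simp
qed

lemma mult_dist_eq_L2_set: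
  assumes "J \<subseteq> {..<p} <+> {..<m}"
    and "\<And>j. j \<in> ({..<p} <+> {..<m}) - J \<Longrightarrow> case_sum l\<^sub>1 \<mu>\<^sub>1 j = 0 \<and> case_sum l\<^sub>2 \<mu>\<^sub>2 j = 0"
  shows "mult_dist p m (l\<^sub>1, \<mu>\<^sub>1) (l\<^sub>2, \<mu>\<^sub>2)
    = L2_set (\<lambda>j. case_sum l\<^sub>2 \<mu>\<^sub>2 j - case_sum l\<^sub>1 \<mu>\<^sub>1 j) J"
proof -
  have "(\<Sum>j\<in>J. (case_sum l\<^sub>2 \<mu>\<^sub>2 j - case_sum l\<^sub>1 \<mu>\<^sub>1 j)\<^sup>2)
      = (\<Sum>j\<in>{..<p} <+> {..<m}. (case_sum l\<^sub>2 \<mu>\<^sub>2 j - case_sum l\<^sub>1 \<mu>\<^sub>1 j)\<^sup>2)"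
    using assms by (intro sum.mono_neutral_left) auto
  then show ?thesis
    by (simp add: mult_dist_def L2_set_def sum.Plus power2_commute)
qed

section \<open>Lipschitz bounds for solutions and multipliers\<close>

theorem theorem6:
  fixes f :: "real^'n \<Rightarrow> real^'r \<Rightarrow> real"
    and h g :: "nat \<Rightarrow> real^'n \<Rightarrow> real^'r \<Rightarrow> real"
    and p m :: nat
    and \<Xi> N :: "(real^'r) set"
    and \<xi>b :: "real^'r" and xb :: "real^'n" and lb \<mu>b :: "nat \<Rightarrow> real"
    and xs :: "real^'r \<Rightarrow> real^'n" and ls \<mu>s :: "real^'r \<Rightarrow> nat \<Rightarrow> real"
    and A :: "real^'n^'n" and L :: "real^'r^'n"
    and J :: "(nat + nat) set"
    and B :: "nat + nat \<Rightarrow> real^'n" and G :: "nat + nat \<Rightarrow> real^'r"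
  assumes f_C2: "C2_on (UNIV \<times> \<Xi>) (\<lambda>(x, \<xi>). f x \<xi>)"
    and h_C2: "\<forall>i<p. C2_on (UNIV \<times> \<Xi>) (\<lambda>(x, \<xi>). h i x \<xi>)"
    and g_C2: "\<forall>i<m. C2_on (UNIV \<times> \<Xi>) (\<lambda>(x, \<xi>). g i x \<xi>)"
    and xib: "\<xi>b \<in> \<Xi>"
    and regular: "regular_minimizer f p h m g \<xi>b xb lb \<mu>b"
    and N: "rel_nhd \<Xi> N \<xi>b"
    and maps: "local_solution_maps f p h m g N xs ls \<mu>s"
    and base: "xs \<xi>b = xb" "\<forall>i<p. ls \<xi>b i = lb i" "\<forall>i<m. \<mu>s \<xi>b i = \<mu>b i"
    and A: "A = hess_xx (lagrangian f p h m g (ls \<xi>b) (\<mu>s \<xi>b)) (xs \<xi>b) \<xi>b"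
    and L: "L = hess_xi_x (lagrangian f p h m g (ls \<xi>b) (\<mu>s \<xi>b)) (xs \<xi>b) \<xi>b"
    and J: "J = active_rows p m g (xs \<xi>b) \<xi>b"
    and B: "B = constr_grad_x h g (xs \<xi>b) \<xi>b"
    and G: "G = constr_grad_xi h g (xs \<xi>b) \<xi>b"
    and A_pd: "pos_definite A"
  shows "locally_lipschitz_at dist
           (sqrt (eig_max A / eig_min A) *
             (onorm ((*v) L) / eig_min A + row_onorm J G / sigma_min_transpose J B))
           N xs \<xi>b \<and>
         locally_lipschitz_at (mult_dist p m)
           ((eig_max A) powr (3/2) / (sigma_min_transpose J B * (eig_min A) powr (1/2)) *
             (onorm ((*v) L) / eig_min A + row_onorm J G / sigma_min_transpose J B))
           N (\<lambda>\<xi>. (ls \<xi>, \<mu>s \<xi>)) \<xi>b"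
proof -
  let ?K = "{..<p} <+> {..<m}"
  define c where "c = case_sum h g"
  define y where "y \<xi> = case_sum (ls \<xi>) (\<mu>s \<xi>)" for \<xi>
  define \<Lambda> where "\<Lambda> = lagrangian f p h m g (ls \<xi>b) (\<mu>s \<xi>b)"
  define z where "z \<xi> = (xs \<xi>, \<xi>)" for \<xi>
  define F where "F = inf (nhds \<xi>b) (principal N)"
  define FF where "FF = F \<times>\<^sub>F F"
  have N\<Xi>: "N \<subseteq> \<Xi>" and \<xi>N: "\<xi>b \<in> N"
    using N xib unfolding rel_nhd_def by auto
  have c_C2: "C2_on (UNIV \<times> \<Xi>) (\<lambda>(x, \<xi>). case_sum h g j x \<xi>)" if "j \<in> ?K" for j
    using that h_C2 g_C2 by (cases j) auto
  have \<Lambda>_C2: "C2_on (UNIV \<times> \<Xi>) (\<lambda>(x, \<xi>). \<Lambda> x \<xi>)"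
    unfolding \<Lambda>_def by (rule C2_on_lagrangian[OF f_C2 c_C2])
  have kkt: "KKT f p h m g \<xi> (xs \<xi>) (ls \<xi>) (\<mu>s \<xi>)" if "\<xi> \<in> N" for \<xi>
    using maps that unfolding local_solution_maps_def by blast
  have licq: "LICQ p h m g \<xi>b (xs \<xi>b)"
    using maps \<xi>N unfolding local_solution_maps_def by blast
  have JK: "J \<subseteq> ?K" unfolding J active_rows_def active_def by auto
  have finJ: "finite J" using JK by (rule finite_subset) simp
  have F_N: "\<forall>\<^sub>F \<xi> in F. \<xi> \<in> N" unfolding F_def eventually_inf_principal by simp
  have F_tendsto: "(\<phi> \<longlongrightarrow> \<phi> \<xi>b) F" if "continuous_on N \<phi>" for \<phi> :: "real^'r \<Rightarrow> 'z::topological_space"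
    unfolding tendsto_def F_def eventually_inf_principal eventually_nhds
    using that \<xi>N unfolding continuous_on_topological by (metis (full_types) Int_iff)
  have y_cont: "continuous_on N (\<lambda>\<xi>. y \<xi> j)" if "j \<in> ?K" for j
    using maps that unfolding local_solution_maps_def y_def by (auto split: sum.split)
  have "continuous_on N xs" using maps unfolding local_solution_maps_def by blast
  then have "continuous_on N z" unfolding z_def by (intro continuous_intros)
  from F_tendsto[OF this] have z_lim: "(z \<longlongrightarrow> (xs \<xi>b, \<xi>b)) F" by (simp add: z_def)

  have strict_\<Lambda>: "has_strict_derivative (\<lambda>w. grad_x \<Lambda> (fst w) (snd w))
      (\<lambda>v. A *v fst v + L *v snd v) (xs \<xi>b, \<xi>b)"
    unfolding A L \<Lambda>_def[symmetric] by (rule strict_derivative_grad_x[OF \<Lambda>_C2 xib])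
  have strict_c: "has_strict_derivative (\<lambda>w. c j (fst w) (snd w))
      (\<lambda>v. B j \<bullet> fst v + G j \<bullet> snd v) (xs \<xi>b, \<xi>b)" if "j \<in> J" for j
    using strict_derivative_function[OF c_C2 xib, of j "xs \<xi>b"] that JK
    unfolding B G constr_grad_x_def constr_grad_xi_def c_def by blast
  have strict_B: "has_strict_derivative (\<lambda>w. constr_grad_x h g (fst w) (snd w) j)
      (\<lambda>v. hess_xx (c j) (xs \<xi>b) \<xi>b *v fst v + hess_xi_x (c j) (xs \<xi>b) \<xi>b *v snd v) (xs \<xi>b, \<xi>b)"
    if "j \<in> J" for j
    using strict_derivative_grad_x[OF c_C2 xib, of j "xs \<xi>b"] that JK
    unfolding constr_grad_x_def c_def by blast
  have A_sa: "(A *v u) \<bullet> v = u \<bullet> (A *v v)" for u v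
    unfolding A \<Lambda>_def[symmetric] by (rule hess_xx_selfadjoint[OF \<Lambda>_C2 xib])

  \<comment> \<open>Constraints inactive at \<open>\<xi>b\<close> stay inactive nearby, so only rows in \<open>J\<close> carry multipliers.\<close>
  have inactive: "\<forall>\<^sub>F \<xi> in F. \<forall>j\<in>?K - J. y \<xi> j = 0"
  proof -
    have "\<forall>\<^sub>F \<xi> in F. y \<xi> j = 0" if j: "j \<in> ?K - J" for j
    proof -
      obtain i where i: "j = Inr i" "i < m" "g i (xs \<xi>b) \<xi>b \<noteq> 0"
        using j unfolding J active_rows_def active_def by auto
      then have neg: "g i (xs \<xi>b) \<xi>b < 0"
        using kkt[OF \<xi>N] by (force simp: KKT_def feasible_def)
      have "has_strict_derivative (\<lambda>w. c j (fst w) (snd w))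
          (\<lambda>v. grad_x (c j) (xs \<xi>b) \<xi>b \<bullet> fst v + grad_xi (c j) (xs \<xi>b) \<xi>b \<bullet> snd v) (xs \<xi>b, \<xi>b)"
        using strict_derivative_function[OF c_C2 xib] j unfolding c_def by blast
      from has_derivative_continuous[OF has_strict_derivative_imp_has_derivative[OF this]]
      have "((\<lambda>\<xi>. c j (fst (z \<xi>)) (snd (z \<xi>))) \<longlongrightarrow> c j (xs \<xi>b) \<xi>b) F"
        using isCont_tendsto_compose[OF _ z_lim] by fastforce
      then have "((\<lambda>\<xi>. g i (xs \<xi>) \<xi>) \<longlongrightarrow> g i (xs \<xi>b) \<xi>b) F"
        by (simp add: i c_def z_def)
      from order_tendstoD(2)[OF this neg] F_N show ?thesis
        by eventually_elim (use kkt i in \<open>simp add: KKT_def y_def\<close>)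
    qed
    then show ?thesis by (simp add: eventually_ball_finite)
  qed
  have inactive_b: "\<forall>j\<in>?K - J. y \<xi>b j = 0"
  proof -
    obtain V where "\<xi>b \<in> V" "\<forall>\<xi>\<in>V. \<xi> \<in> N \<longrightarrow> (\<forall>j\<in>?K - J. y \<xi> j = 0)"
      using inactive unfolding F_def eventually_inf_principal eventually_nhds by blast
    then show ?thesis using \<xi>N by blast
  qed
  \<comment> \<open>\<open>\<Lambda>\<close> has the multipliers fixed at their values at \<open>\<xi>b\<close>; the sum restores the actual ones.\<close>
  have stationary: "\<forall>\<^sub>F \<xi> in F. grad_x \<Lambda> (fst (z \<xi>)) (snd (z \<xi>))
      + (\<Sum>j\<in>J. (y \<xi> j - y \<xi>b j) *\<^sub>R constr_grad_x h g (fst (z \<xi>)) (snd (z \<xi>)) j) = 0"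
    using inactive F_N
  proof eventually_elim
    case (elim \<xi>)
    let ?\<gamma> = "constr_grad_x h g (xs \<xi>) \<xi>"
    have grad: "grad_x (lagrangian f p h m g l \<mu>) (xs \<xi>) \<xi>
        = grad_x f (xs \<xi>) \<xi> + (\<Sum>j\<in>?K. case_sum l \<mu> j *\<^sub>R ?\<gamma> j)" for l \<mu>
      by (rule grad_x_lagrangian[OF f_C2 c_C2]) (use elim N\<Xi> in auto)
    have "0 = grad_x \<Lambda> (xs \<xi>) \<xi> + (\<Sum>j\<in>?K. (y \<xi> j - y \<xi>b j) *\<^sub>R ?\<gamma> j)"
      using kkt[OF elim(2)] unfolding KKT_def \<Lambda>_def grad y_def
      by (simp add: algebra_simps sum_subtractf)
    also have "(\<Sum>j\<in>?K. (y \<xi> j - y \<xi>b j) *\<^sub>R ?\<gamma> j) = (\<Sum>j\<in>J. (y \<xi> j - y \<xi>b j) *\<^sub>R ?\<gamma> j)"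
      using elim(1) inactive_b JK by (intro sum.mono_neutral_right) auto
    finally show ?case by (simp add: z_def)
  qed

  define lo hi where "lo = eig_min A" "hi = eig_max A"
  \<comment> \<open>For \<open>J = {}\<close> this is \<open>inverse 0 = 0\<close>, and the bound on multipliers below then holds trivially.\<close>
  define \<tau> where "\<tau> = inverse (sigma_min_transpose J B)"
  define nL nG where "nL = onorm ((*v) L)" "nG = row_onorm J G"
  have lo: "0 < lo" using pos_definite_imp_eig_min_pos[OF A_sa A_pd] by (simp add: lo_hi_def)
  have hi: "lo \<le> hi" using eig_min_le_eig_max[OF A_sa] by (simp add: lo_hi_def)
  have \<tau>: "0 \<le> \<tau> \<and> L2_set v J \<le> \<tau> * norm (\<Sum>j\<in>J. v j *\<^sub>R B j)" for v
  proof (cases "J = {}")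
    case False
    have "inj_on B J" "independent (B ` J)" using licq unfolding LICQ_def J B by blast+
    from sigma_min_transpose_bound[OF finJ False this] show ?thesis
      by (simp add: \<tau>_def field_simps)
  qed (simp add: \<tau>_def sigma_min_transpose_def)
  have nL: "0 \<le> nL" "norm (L *v v) \<le> nL * norm v" for v
    unfolding nL_nG_def using onorm_pos_le onorm by blast+
  have nG: "0 \<le> nG" "L2_set (\<lambda>j. G j \<bullet> v) J \<le> nG * norm v" for v
    unfolding nL_nG_def by (rule row_onorm_nonneg row_onorm_bound)+
  define M\<^sub>1 M\<^sub>2 K where "M\<^sub>1 = sqrt (hi / lo)" "M\<^sub>2 = hi powr (3/2) * \<tau> / lo powr (1/2)"
    "K = nL / lo + \<tau> * nG"
  have M1: "0 \<le> M\<^sub>1" and M2: "0 \<le> M\<^sub>2" and K0: "0 \<le> K"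
    using lo hi \<tau> nL(1) nG(1) by (auto simp: M\<^sub>1_M\<^sub>2_K_def)

  have main: "\<forall>\<^sub>F q in FF. dist (xs (fst q)) (xs (snd q)) \<le> M\<^sub>1 * (k * norm (snd q - fst q)) \<and>
      mult_dist p m (ls (fst q), \<mu>s (fst q)) (ls (snd q), \<mu>s (snd q)) \<le> M\<^sub>2 * (k * norm (snd q - fst q))"
    if k: "K < k" for k
  proof -
    have c0: "0 \<le> 1 / lo + \<tau>" using lo \<tau> by simp
    obtain e where e: "0 < e" and absorb: "\<And>a b \<delta> X. a \<le> M\<^sub>1 * X \<Longrightarrow> b \<le> M\<^sub>2 * X \<Longrightarrow> 0 \<le> \<delta> \<Longrightarrow>
        X \<le> K * \<delta> + e * (1 / lo + \<tau>) * (a + b + \<delta>) \<Longrightarrow> X \<le> k * \<delta>"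
      by (rule absorb_relative_error[OF M1 M2 K0 c0 k]) (rule that)
    have y_lim: "((\<lambda>\<xi>. y \<xi> j) \<longlongrightarrow> y \<xi>b j) F" if "j \<in> J" for j
      using F_tendsto[OF y_cont] JK that by blast
    have ev1: "\<forall>\<^sub>F q in FF. norm ((A *v fst (z (snd q) - z (fst q)) + L *v snd (z (snd q) - z (fst q)))
          + (\<Sum>j\<in>J. (y (snd q) j - y (fst q) j) *\<^sub>R B j))
        \<le> e * (norm (z (snd q) - z (fst q)) + L2_set (\<lambda>j. y (snd q) j - y (fst q) j) J)"
      using stationarity_expansion[OF finJ strict_\<Lambda> strict_B z_lim y_lim stationary e]
      unfolding FF_def by (simp add: B)
    have ev2: "\<forall>\<^sub>F q in FF. L2_set (\<lambda>j. c j (fst (z (snd q))) (snd (z (snd q)))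
          - c j (fst (z (fst q))) (snd (z (fst q)))
          - (B j \<bullet> fst (z (snd q) - z (fst q)) + G j \<bullet> snd (z (snd q) - z (fst q)))) J
        \<le> e * norm (z (snd q) - z (fst q))"
      using family_expansion[OF finJ strict_c z_lim e] unfolding FF_def by simp
    from ev1 ev2 eventually_pair_both[OF F_N, folded FF_def]
      eventually_pair_both[OF inactive, folded FF_def]
    show ?thesis
    proof eventually_elim
      case (elim q)
      define \<xi>\<^sub>1 \<xi>\<^sub>2 where "\<xi>\<^sub>1 = fst q" "\<xi>\<^sub>2 = snd q"
      define dx d\<xi> dy dc where "dx = xs \<xi>\<^sub>2 - xs \<xi>\<^sub>1" "d\<xi> = \<xi>\<^sub>2 - \<xi>\<^sub>1"
        "dy = (\<lambda>j. y \<xi>\<^sub>2 j - y \<xi>\<^sub>1 j)" "dc = (\<lambda>j. c j (xs \<xi>\<^sub>2) \<xi>\<^sub>2 - c j (xs \<xi>\<^sub>1) \<xi>\<^sub>1)"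
      have zdiff: "z \<xi>\<^sub>2 - z \<xi>\<^sub>1 = (dx, d\<xi>)" by (simp add: z_def dx_d\<xi>_dy_dc_def)
      define err where "err = A *v dx + L *v d\<xi> + (\<Sum>j\<in>J. dy j *\<^sub>R B j)"
      define er where "er j = dc j - (B j \<bullet> dx + G j \<bullet> d\<xi>)" for j
      define t where "t = norm dx + L2_set dy J + norm d\<xi>"
      have nz: "norm (dx, d\<xi>) \<le> norm dx + norm d\<xi>" by (rule norm_Pair_le)
      have nt: "norm (dx, d\<xi>) \<le> t" unfolding t_def using nz L2_set_nonneg[of dy J] by linarith
      have "norm err \<le> e * (norm (dx, d\<xi>) + L2_set dy J)"
        using elim(1) unfolding \<xi>\<^sub>1_\<xi>\<^sub>2_def[symmetric] zdiff err_def by (simp add: dx_d\<xi>_dy_dc_def)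
      also have "\<dots> \<le> e * t" using nz e by (intro mult_left_mono) (auto simp: t_def)
      finally have err: "norm err \<le> e * t" .
      have "L2_set er J \<le> e * norm (dx, d\<xi>)"
        using elim(2) unfolding \<xi>\<^sub>1_\<xi>\<^sub>2_def[symmetric] zdiff er_def
        by (simp add: dx_d\<xi>_dy_dc_def z_def)
      also have "\<dots> \<le> e * t" using nt e by simp
      finally have er: "L2_set er J \<le> e * t" .
      define r where "r j = G j \<bullet> d\<xi> + er j" for j
      define X where "X = norm (L *v d\<xi> - err) / lo + \<tau> * L2_set r J"
      \<comment> \<open>The errors enter as perturbations of the data: \<open>L *v d\<xi> - err\<close> in place of \<open>L *v d\<xi>\<close>, and \<open>r\<close> in
        place of \<open>j \<mapsto> G j \<bullet> d\<xi>\<close>.\<close>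
      have stat: "A *v dx + (L *v d\<xi> - err) + (\<Sum>j\<in>J. dy j *\<^sub>R B j) = 0"
        by (simp add: err_def)
      have mono: "0 \<le> dy j * (B j \<bullet> dx + r j)" if "j \<in> J" for j
      proof -
        have N12: "\<xi>\<^sub>1 \<in> N" "\<xi>\<^sub>2 \<in> N" using elim(3) by (auto simp: \<xi>\<^sub>1_\<xi>\<^sub>2_def)
        have "B j \<bullet> dx + r j = dc j" by (simp add: r_def er_def)
        then show ?thesis
          using KKT_monotone[OF kkt[OF N12(1)] kkt[OF N12(2)], of j] that JK
          by (auto simp: dx_d\<xi>_dy_dc_def c_def y_def)
      qed
      note bounds = monotone_saddle_point_bounds[where A = "(*v) A" and B = B and lo = lo and hi = hi
          and \<tau> = \<tau> and y = dy and x = dx and r = r, OF matrix_vector_mul_linear A_sa lo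
          eig_min_le_quadratic_form[OF A_sa, folded lo_hi_def(1)] hi
          quadratic_form_le_eig_max[OF A_sa, folded lo_hi_def(2)] conjunct1[OF \<tau>]
          conjunct2[OF \<tau>] stat mono]
      have x_le: "norm dx \<le> M\<^sub>1 * X" and y_le: "L2_set dy J \<le> M\<^sub>2 * X"
        using bounds unfolding M\<^sub>1_M\<^sub>2_K_def X_def by blast+
      have "norm (L *v d\<xi> - err) \<le> nL * norm d\<xi> + e * t"
        using norm_triangle_ineq4[of "L *v d\<xi>" err] nL(2)[of d\<xi>] err by linarith
      moreover have "L2_set r J \<le> nG * norm d\<xi> + e * t"
        using L2_set_triangle_ineq[of "\<lambda>j. G j \<bullet> d\<xi>" er J] nG(2)[of d\<xi>] er
        unfolding r_def by linarith
      ultimately have "X \<le> (nL * norm d\<xi> + e * t) / lo + \<tau> * (nG * norm d\<xi> + e * t)"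
        unfolding X_def using lo \<tau> by (intro add_mono divide_right_mono mult_left_mono) auto
      also have "\<dots> = K * norm d\<xi> + e * (1 / lo + \<tau>) * t"
        by (simp add: M\<^sub>1_M\<^sub>2_K_def algebra_simps add_divide_distrib)
      finally have "X \<le> k * norm d\<xi>"
        unfolding t_def by (intro absorb[OF x_le y_le]) auto
      then have "norm dx \<le> M\<^sub>1 * (k * norm d\<xi>)" "L2_set dy J \<le> M\<^sub>2 * (k * norm d\<xi>)"
        using x_le y_le M1 M2 by (meson mult_left_mono order_trans)+
      moreover have "mult_dist p m (ls \<xi>\<^sub>1, \<mu>s \<xi>\<^sub>1) (ls \<xi>\<^sub>2, \<mu>s \<xi>\<^sub>2) = L2_set dy J"
        unfolding dx_d\<xi>_dy_dc_def y_def
        by (rule mult_dist_eq_L2_set[OF JK]) (use elim(4) in \<open>unfold y_def \<xi>\<^sub>1_\<xi>\<^sub>2_def, blast\<close>)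
      moreover have "dist (xs \<xi>\<^sub>1) (xs \<xi>\<^sub>2) = norm dx"
        by (simp add: dx_d\<xi>_dy_dc_def dist_norm norm_minus_commute)
      ultimately show ?case by (simp add: dx_d\<xi>_dy_dc_def \<xi>\<^sub>1_\<xi>\<^sub>2_def)
    qed
  qed
  have "locally_lipschitz_at dist (M\<^sub>1 * K) N xs \<xi>b"
    by (rule locally_lipschitz_atI_scaled[OF M1], rule eventually_mono,
        erule main[unfolded FF_def F_def]) simp
  moreover have "locally_lipschitz_at (mult_dist p m) (M\<^sub>2 * K) N (\<lambda>\<xi>. (ls \<xi>, \<mu>s \<xi>)) \<xi>b"
    by (rule locally_lipschitz_atI_scaled[OF M2], rule eventually_mono,
        erule main[unfolded FF_def F_def]) simp
  moreover have "K = onorm ((*v) L) / eig_min A + row_onorm J G / sigma_min_transpose J B"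
    unfolding M\<^sub>1_M\<^sub>2_K_def lo_hi_def nL_nG_def \<tau>_def by (simp only: divide_inverse mult.commute)
  moreover have "M\<^sub>1 = sqrt (eig_max A / eig_min A)"
    unfolding M\<^sub>1_M\<^sub>2_K_def lo_hi_def ..
  moreover have "M\<^sub>2 = eig_max A powr (3/2) / (sigma_min_transpose J B * eig_min A powr (1/2))"
    unfolding M\<^sub>1_M\<^sub>2_K_def lo_hi_def \<tau>_def
    by (simp only: divide_inverse inverse_mult_distrib mult.assoc)
  ultimately show ?thesis by simp
qed

end
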